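(* Consider $f(x)=\frac1n\sum_{i=1}^n f_i(x)$, $x\in\mathbb{R}^d$. Assume there exists $f_*\in\mathbb{R}$ with $f(x)\ge f_*$ for all $x\in\mathbb{R}^d$, and that $f_i$ is $L_i$-smooth for all $i\in\{1,\dots,n\}$, i.e. $\|\nabla f_i(x)-\nabla f_i(y)\|\le L_i\|x-y\|$ for all $x,y\in\mathbb{R}^d$. Put $L^2=\frac1n\sum_{i=1}^nL_i^2$ and $\Delta_0=f(x^0)-f_*$. Let $\mathcal{Q}$ be a quantization operator with parameter $\omega$ and expected density $\zeta_{\mathcal Q}$, and let $p=\frac{\zeta_{\mathcal Q}r}{dn}$, where $r\le n$. If $$\gamma\le\frac{1}{L\left(1+\sqrt{\frac{1+\omega}{r}\left(\frac{dn}{\zeta_{\mathcal Q}r}-1\right)}\right)},$$ then PP-MARINA requires $$K=\mathcal{O}\left(\frac{\Delta_0L}{\varepsilon^2}\left(1+\sqrt{\frac{1+\omega}{r}\left(\frac{dn}{\zeta_{\mathcal Q}r}-1\right)}\right)\right)$$ iterations/communication rounds to achieve $\mathbf{E}[\|\nabla f(\hat x^K)\|^2]\le\varepsilon^2$, and the expected total communication cost is $$\mathcal{O}\left(dn+\frac{\Delta_0L}{\varepsilon^2}\left(\zeta_{\mathcal Q}r+\sqrt{(1+\omega)\zeta_{\mathcal Q}(dn-\zeta_{\mathcal Q}r)}\right)\right)$$ under an assumption that the communication cost is proportional to the number of non-zero components of transmitted vectors from workers to the server.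
   Context: $\|\cdot\|$ is the Euclidean norm; $\|y\|_0$ is the number of non-zero components of $y\in\mathbb{R}^d$. The total communication cost is that of all workers together. Quantization operator: a stochastic mapping $\mathcal{Q}:\mathbb{R}^d\to\mathbb{R}^d$ for which there is $\omega>0$ with $\mathbf{E}[\mathcal{Q}(x)]=x$ and $\mathbf{E}[\|\mathcal{Q}(x)-x\|^2]\le\omega\|x\|^2$ for any $x\in\mathbb{R}^d$. Its expected density is $\zeta_{\mathcal Q}=\sup_{x\in\mathbb{R}^d}\mathbf{E}[\|\mathcal{Q}(x)\|_0]$. PP-MARINA (a distributed method with $n$ workers, worker $i$ having access to $f_i$, and a server; input: starting point $x^0$, stepsize $\gamma$, probability $p\in(0,1]$, number of iterations $K$, clients-batchsize $r\le n$): initialize $g^0=\nabla f(x^0)$. For $k=0,\dots,K-1$: sample $c_k\sim\mathrm{Bernoulli}(p)$; choose $I'_k=\{1,\dots,n\}$ if $c_k=1$, and choose $I'_k$ as the set of $r$ i.i.d. samples from the uniform distribution over $\{1,\dots,n\}$ otherwise; broadcast $g^k$ to all workers; each worker $i=1,\dots,n$ in parallel computes $x^{k+1}=x^k-\gamma g^k$ and sets $g_i^{k+1}=\nabla f_i(x^{k+1})$ if $c_k=1$, and $g_i^{k+1}=g^k+\mathcal{Q}(\nabla f_i(x^{k+1})-\nabla f_i(x^k))$ if $c_k=0$; then set $g^{k+1}=\nabla f(x^{k+1})$ if $c_k=1$, and $g^{k+1}=g^k+\frac1r\sum_{i_k\in I'_k}\mathcal{Q}(\nabla f_{i_k}(x^{k+1})-\nabla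 f_{i_k}(x^k))$ if $c_k=0$. Return $\hat x^K$ chosen uniformly at random from $\{x^k\}_{k=0}^{K-1}$.
   Formalization: The O-bounds fail for arbitrarily small stepsizes, so γ is assumed positive and at least θ times its upper bound, for any θ in (0,1], with O-constants 4/θ and 8/θ; also K is at least 1, so the iteration bound is the maximum of 1 and the O-expression. *)

theory Defs
  imports "HOL-Probability.Probability"
begin

definition grad :: "('a::euclidean_space \<Rightarrow> real) \<Rightarrow> 'a \<Rightarrow> 'a" where
  "grad f x = (THE g. GDERIV f x :> g)"

definition smooth :: "real \<Rightarrow> ('a::euclidean_space \<Rightarrow> real) \<Rightarrow> bool" where
  "smooth L f \<longleftrightarrow> (\<forall>x. f differentiable (at x)) \<and>
     (\<forall>x y. norm (grad f x - grad f y) \<le> L * norm (x - y))"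

definition nnz :: "real ^ 'd \<Rightarrow> nat" where
  "nnz y = card {j. y $ j \<noteq> 0}"

text \<open>A stochastic mapping is a Markov kernel: \<open>Q x\<close> is the law of the random vector $Q(x)$.\<close>

definition quantization :: "real \<Rightarrow> (real ^ 'd \<Rightarrow> (real ^ 'd) measure) \<Rightarrow> bool" where
  "quantization \<omega> Q \<longleftrightarrow> \<omega> > 0 \<and> Q \<in> borel \<rightarrow>\<^sub>M prob_algebra borel \<and>
     (\<forall>x. has_bochner_integral (Q x) (\<lambda>y. y) x) \<and>
     (\<forall>x. (\<integral>\<^sup>+ y. ennreal ((norm (y - x))\<^sup>2) \<partial>Q x) \<le> ennreal (\<omega> * (norm x)\<^sup>2))"

definition expected_density :: "(real ^ 'd \<Rightarrow> (real ^ 'd) measure) \<Rightarrow> real" where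
  "expected_density Q = (SUP x. \<integral>y. real (nnz y) \<partial>Q x)"

definition objective :: "nat \<Rightarrow> (nat \<Rightarrow> 'a \<Rightarrow> real) \<Rightarrow> 'a \<Rightarrow> real" where
  "objective n f x = (1 / real n) * (\<Sum>i=1..n. f i x)"

text \<open>A state \<open>(x, g, b)\<close> consists of the iterate, the gradient estimator, and the number \<open>b\<close> of
  non-zero components of all vectors that the workers have sent to the server so far.\<close>

type_synonym 'd state = "(real ^ 'd) \<times> (real ^ 'd) \<times> nat"

abbreviation state_space :: "'d::finite state measure" where
  "state_space \<equiv> borel \<Otimes>\<^sub>M borel \<Otimes>\<^sub>M count_space UNIV"

text \<open>In a compressed round, \<open>I\<close> lists the \<open>r\<close> i.i.d. sampled workers, repetitions allowed, and
  \<open>m j\<close> is the message of the worker in position \<open>j\<close>; given \<open>I\<close>, the messages of the \<open>r\<close>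
  positions are independent, also when a worker is sampled more than once.\<close>

definition pp_marina_step ::
  "nat \<Rightarrow> (nat \<Rightarrow> real ^ 'd \<Rightarrow> real) \<Rightarrow> (real ^ 'd \<Rightarrow> (real ^ 'd) measure) \<Rightarrow> real \<Rightarrow> real \<Rightarrow> nat
    \<Rightarrow> 'd state \<Rightarrow> 'd::finite state measure" where
  "pp_marina_step n f Q \<gamma> p r = (\<lambda>(x, g, b).
     let x' = x - \<gamma> *\<^sub>R g in
     measure_pmf (bernoulli_pmf p) \<bind> (\<lambda>c.
       if c then
         return state_space
           (x', grad (objective n f) x', b + (\<Sum>i=1..n. nnz (grad (f i) x')))
       else
         measure_pmf (replicate_pmf r (pmf_of_set {1..n})) \<bind> (\<lambda>I.
         PiM {..<r} (\<lambda>j. Q (grad (f (I ! j)) x' - grad (f (I ! j)) x)) \<bind> (\<lambda>m.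
           return state_space
             (x', g + (1 / real r) *\<^sub>R (\<Sum>j<r. m j), b + (\<Sum>j<r. nnz (m j)))))))"

text \<open>The workers have to send their full gradients once to initialise the estimator with
  $\nabla f(x^0)$, so the communication count starts with these.\<close>

primrec pp_marina ::
  "nat \<Rightarrow> (nat \<Rightarrow> real ^ 'd \<Rightarrow> real) \<Rightarrow> (real ^ 'd \<Rightarrow> (real ^ 'd) measure) \<Rightarrow> real \<Rightarrow> real \<Rightarrow> nat
    \<Rightarrow> real ^ 'd \<Rightarrow> nat \<Rightarrow> 'd::finite state measure" where
  "pp_marina n f Q \<gamma> p r x0 0 =
     return state_space (x0, grad (objective n f) x0, \<Sum>i=1..n. nnz (grad (f i) x0))"
| "pp_marina n f Q \<gamma> p r x0 (Suc k) =
     pp_marina n f Q \<gamma> p r x0 k \<bind> pp_marina_step n f Q \<gamma> p r"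

text \<open>The law of $\hat x^K$: the index \<open>k\<close> is drawn independently of the trajectory, so this is the
  mixture of the laws of $x^0, \dots, x^{K-1}$. For \<open>K = 0\<close> it is meaningless.\<close>

definition pp_marina_output ::
  "nat \<Rightarrow> (nat \<Rightarrow> real ^ 'd \<Rightarrow> real) \<Rightarrow> (real ^ 'd \<Rightarrow> (real ^ 'd) measure) \<Rightarrow> real \<Rightarrow> real \<Rightarrow> nat
    \<Rightarrow> real ^ 'd \<Rightarrow> nat \<Rightarrow> (real ^ 'd::finite) measure" where
  "pp_marina_output n f Q \<gamma> p r x0 K =
     measure_pmf (pmf_of_set {..<K}) \<bind> (\<lambda>k. distr (pp_marina n f Q \<gamma> p r x0 k) borel fst)"

text \<open>The expected total communication cost of \<open>K\<close> iterations, with cost one per non-zero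
  component of a vector sent from a worker to the server.\<close>

definition expected_cost ::
  "nat \<Rightarrow> (nat \<Rightarrow> real ^ 'd \<Rightarrow> real) \<Rightarrow> (real ^ 'd \<Rightarrow> (real ^ 'd) measure) \<Rightarrow> real \<Rightarrow> real \<Rightarrow> nat
    \<Rightarrow> real ^ 'd::finite \<Rightarrow> nat \<Rightarrow> ennreal" where
  "expected_cost n f Q \<gamma> p r x0 K =
     (\<integral>\<^sup>+ s. of_nat (snd (snd s)) \<partial>pp_marina n f Q \<gamma> p r x0 K)"

end

theory Submission
  imports Defs
begin

text \<open>In a compressed round the increment of the estimator \<open>g\<close> is an unbiased estimate of the change
  of \<open>\<nabla>f\<close>, so the squared error \<open>\<parallel>g - \<nabla>f(x)\<parallel>\<^sup>2\<close> grows in expectation by at most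
  \<open>(1 + \<omega>) L\<^sup>2 \<gamma>\<^sup>2 \<parallel>g\<parallel>\<^sup>2 / r\<close>, and with probability \<open>p\<close> it is reset to zero. Adding
  \<open>\<gamma> / (2 p)\<close> times this error to \<open>f(x) - f\<^sub>*\<close> gives a potential that, for the admissible step
  sizes, decreases in expectation by at least \<open>\<gamma> / 2 \<cdot> \<parallel>\<nabla>f(x)\<parallel>\<^sup>2\<close> per iteration. Summing up, the
  mean of \<open>\<parallel>\<nabla>f\<parallel>\<^sup>2\<close> over \<open>K\<close> iterates is at most \<open>2 \<Delta>\<^sub>0 / (\<gamma> K)\<close>. The choice of \<open>p\<close>
  balances the two kinds of rounds: \<open>p d n = \<zeta> r\<close>, so a round costs at most \<open>2 \<zeta> r\<close> on average.\<close>

subsection \<open>Gradients and smoothness\<close>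

lemma GDERIV_unique:
  assumes "GDERIV f x :> D" and "GDERIV f x :> E"
  shows "D = E"
proof -
  have "(\<lambda>h. inner h D) = (\<lambda>h. inner h E)"
    using assms unfolding gderiv_def by (rule has_derivative_unique)
  then show ?thesis by (metis inner_commute vector_eq_rdot)
qed

text \<open>Since \<open>grad\<close> is a definite description, it needs a witness: the Riesz
  representative of the derivative, assembled from its values on \<open>Basis\<close>.\<close>

lemma GDERIV_grad:
  assumes "f differentiable (at x)"
  shows "GDERIV f x :> grad f x"
proof -
  obtain f' where f': "(f has_derivative f') (at x)"
    using assms by (auto simp: differentiable_def)
  then have "linear f'" by (rule has_derivative_linear)
  have "f' h = inner h (\<Sum>b\<in>Basis. f' b *\<^sub>R b)" for h
  proof -
    have "f' h = f' (\<Sum>b\<in>Basis. inner h b *\<^sub>R b)" by (simp add: euclidean_representation)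
    also have "\<dots> = (\<Sum>b\<in>Basis. inner h b * f' b)"
      using \<open>linear f'\<close> by (simp add: linear_sum linear_cmul)
    finally show ?thesis by (simp add: inner_sum_right mult.commute)
  qed
  then have "f' = (\<lambda>h. inner h (\<Sum>b\<in>Basis. f' b *\<^sub>R b))" by blast
  with f' have D: "GDERIV f x :> (\<Sum>b\<in>Basis. f' b *\<^sub>R b)"
    by (simp add: gderiv_def)
  then show ?thesis unfolding grad_def by (rule theI) (rule GDERIV_unique[OF _ D])
qed

lemma grad_eqI:
  assumes "GDERIV f x :> D"
  shows "grad f x = D"
  unfolding grad_def using assms by (rule the_equality) (rule GDERIV_unique[OF _ assms])

text \<open>Continuity is wanted for the Borel measurability of the gradients. \<open>smooth\<close>
  does not state that its constant is nonnegative while \<open>lipschitz_on\<close> demands it,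
  whence \<open>\<bar>L\<bar> + 1\<close>.\<close>

lemma smooth_continuous_grad:
  assumes "smooth L f"
  shows "continuous_on UNIV (grad f)"
proof -
  have "L \<le> \<bar>L\<bar> + 1" by simp
  then have "norm (grad f x - grad f y) \<le> (\<bar>L\<bar> + 1) * norm (x - y)" for x y
    using assms mult_right_mono[of L "\<bar>L\<bar> + 1" "norm (x - y)"] unfolding smooth_def
    by (meson norm_ge_zero order_trans)
  then have "(\<bar>L\<bar> + 1)-lipschitz_on UNIV (grad f)"
    by (intro lipschitz_onI) (auto simp: dist_norm)
  then show ?thesis by (rule lipschitz_on_continuous_on)
qed

lemma smooth_upper_bound:
  assumes "smooth L f"
  shows "f (x + h) \<le> f x + inner (grad f x) h + L / 2 * (norm h)\<^sup>2"
proof -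
  \<comment> \<open>Up to the constant \<open>f x\<close>, \<open>\<phi>\<close> is \<open>f\<close>
    on the segment minus the claimed quadratic bound. For \<open>t \<ge> 0\<close> its derivative is
    nonpositive by Cauchy-Schwarz and the Lipschitz condition.\<close>
  define \<phi> where "\<phi> t = f (x + t *\<^sub>R h) - t * inner (grad f x) h - L / 2 * t\<^sup>2 * (norm h)\<^sup>2" for t :: real
  have d: "(\<phi> has_real_derivative (inner (grad f (x + t *\<^sub>R h) - grad f x) h - L * t * (norm h)\<^sup>2)) (at t)" for t
  proof -
    have "GDERIV f (x + t *\<^sub>R h) :> grad f (x + t *\<^sub>R h)"
      using assms by (intro GDERIV_grad) (auto simp: smooth_def)
    then have "((\<lambda>t. f (x + t *\<^sub>R h)) has_derivative (\<lambda>s. inner (s *\<^sub>R h) (grad f (x + t *\<^sub>R h)))) (at t)"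
      unfolding gderiv_def
      by (rule has_derivative_compose[rotated]) (auto intro!: derivative_eq_intros)
    then have "((\<lambda>t. f (x + t *\<^sub>R h)) has_real_derivative inner (grad f (x + t *\<^sub>R h)) h) (at t)"
      by (simp add: has_field_derivative_def inner_commute mult_commute_abs)
    then show ?thesis unfolding \<phi>_def
      by (auto intro!: derivative_eq_intros simp: algebra_simps)
  qed
  have "\<phi> 1 \<le> \<phi> 0"
  proof (rule DERIV_nonpos_imp_nonincreasing[of 0 1 \<phi>])
    fix t :: real
    assume t: "0 \<le> t" "t \<le> 1"
    have "inner (grad f (x + t *\<^sub>R h) - grad f x) h \<le> norm (grad f (x + t *\<^sub>R h) - grad f x) * norm h"
      by (rule norm_cauchy_schwarz)
    also have "\<dots> \<le> L * norm (x + t *\<^sub>R h - x) * norm h"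
      using assms unfolding smooth_def by (intro mult_right_mono norm_ge_zero) blast
    also have "\<dots> = L * t * (norm h)\<^sup>2" using t by (simp add: power2_eq_square)
    finally show "\<exists>y. DERIV \<phi> t :> y \<and> y \<le> 0" by (intro exI[of _ "inner (grad f (x + t *\<^sub>R h) - grad f x) h - L * t * (norm h)\<^sup>2"]) (simp add: d)
  qed simp
  then show ?thesis by (simp add: \<phi>_def)
qed

lemma GDERIV_objective:
  assumes "\<And>i. i \<in> {1..n} \<Longrightarrow> f i differentiable (at x)"
  shows "GDERIV (objective n f) x :> (1 / real n) *\<^sub>R (\<Sum>i=1..n. grad (f i) x)"
proof -
  have "(f i has_derivative (\<lambda>h. inner h (grad (f i) x))) (at x)" if "i \<in> {1..n}" for i
    using GDERIV_grad[OF assms[OF that]] by (simp add: gderiv_def)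
  then have "((\<lambda>x. 1 / real n * (\<Sum>i=1..n. f i x)) has_derivative
      (\<lambda>h. 1 / real n * (\<Sum>i=1..n. inner h (grad (f i) x)))) (at x)"
    by (intro has_derivative_mult_right has_derivative_sum)
  then show ?thesis
    unfolding gderiv_def objective_def[abs_def] by (simp add: inner_sum_right)
qed

lemma grad_objective:
  assumes "\<And>i. i \<in> {1..n} \<Longrightarrow> smooth (Ls i) (f i)"
  shows "grad (objective n f) x = (1 / real n) *\<^sub>R (\<Sum>i=1..n. grad (f i) x)"
  using assms by (intro grad_eqI GDERIV_objective) (auto simp: smooth_def)

lemma smooth_sq_diff:
  assumes "smooth L f"
  shows "(norm (grad f x - grad f y))\<^sup>2 \<le> L\<^sup>2 * (norm (x - y))\<^sup>2"
  using assms power_mono[of "norm (grad f x - grad f y)" "L * norm (x - y)" 2]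
  by (auto simp: smooth_def power_mult_distrib)

text \<open>By Cauchy-Schwarz the squared norm of a mean is at most the mean of the squared norms,
  so the root mean square of the \<open>Ls i\<close> serves as a constant.\<close>

lemma smooth_objective:
  assumes sm: "\<And>i. i \<in> {1..n} \<Longrightarrow> smooth (Ls i) (f i)"
  shows "smooth (sqrt ((1 / real n) * (\<Sum>i=1..n. (Ls i)\<^sup>2))) (objective n f)"
  unfolding smooth_def
proof (intro conjI allI)
  fix x
  show "objective n f differentiable (at x)"
    using GDERIV_objective[of n f x] sm by (auto simp: smooth_def gderiv_def differentiable_def)
next
  fix x y :: 'a
  let ?d = "\<lambda>i. grad (f i) x - grad (f i) y"
  have g: "grad (objective n f) z = (1 / real n) *\<^sub>R (\<Sum>i=1..n. grad (f i) z)" for z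
    by (rule grad_objective) (rule sm)
  show "norm (grad (objective n f) x - grad (objective n f) y)
      \<le> sqrt ((1 / real n) * (\<Sum>i=1..n. (Ls i)\<^sup>2)) * norm (x - y)"
  \<comment> \<open>For \<open>n = 0\<close> the factor \<open>1 / real n\<close> is 0 by
    convention, so both gradients vanish.\<close>
  proof (cases "n = 0")
    case False
    have "(norm (\<Sum>i=1..n. ?d i))\<^sup>2 \<le> (\<Sum>i=1..n. norm (?d i))\<^sup>2"
      by (intro power_mono norm_sum) auto
    also have "\<dots> \<le> real n * (\<Sum>i=1..n. (norm (?d i))\<^sup>2)"
      using sum_squared_le_sum_of_squares[of "\<lambda>i. norm (?d i)" "{1..n}"] by (simp add: mult.commute)
    also have "\<dots> \<le> real n * (\<Sum>i=1..n. (Ls i)\<^sup>2 * (norm (x - y))\<^sup>2)"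
      by (intro mult_left_mono sum_mono smooth_sq_diff sm) auto
    finally have *: "(norm (\<Sum>i=1..n. ?d i))\<^sup>2 \<le> real n * (\<Sum>i=1..n. (Ls i)\<^sup>2) * (norm (x - y))\<^sup>2"
      by (simp add: sum_distrib_right mult.assoc)
    have "grad (objective n f) x - grad (objective n f) y = (1 / real n) *\<^sub>R (\<Sum>i=1..n. ?d i)"
      by (simp add: g sum_subtractf scaleR_diff_right)
    then have "norm (grad (objective n f) x - grad (objective n f) y) = norm (\<Sum>i=1..n. ?d i) / real n"
      by simp
    also have "\<dots> = sqrt ((norm (\<Sum>i=1..n. ?d i))\<^sup>2) / real n" by simp
    also have "\<dots> \<le> sqrt (real n * (\<Sum>i=1..n. (Ls i)\<^sup>2) * (norm (x - y))\<^sup>2) / real n"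
      by (rule divide_right_mono[OF real_sqrt_le_mono[OF *]]) simp
    also have "\<dots> = sqrt ((1 / real n) * (\<Sum>i=1..n. (Ls i)\<^sup>2)) * norm (x - y)"
      using False by (simp add: real_sqrt_mult real_sqrt_divide field_simps)
    finally show ?thesis .
  qed (use g in simp)
qed

text \<open>The polarization identity trades the inner product of gradient and estimator for squared
  norms, which isolates the estimation error \<open>g - grad f x\<close>.\<close>

lemma inexact_descent:
  assumes "smooth L f" and "0 < \<gamma>"
  shows "f (x - \<gamma> *\<^sub>R g) \<le> f x - \<gamma> / 2 * (norm (grad f x))\<^sup>2
    - (\<gamma> / 2 - L * \<gamma>\<^sup>2 / 2) * (norm g)\<^sup>2 + \<gamma> / 2 * (norm (g - grad f x))\<^sup>2"
proof -
  have "f (x + - (\<gamma> *\<^sub>R g)) \<le> f x + inner (grad f x) (- (\<gamma> *\<^sub>R g)) + L / 2 * (norm (- (\<gamma> *\<^sub>R g)))\<^sup>2"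
    by (rule smooth_upper_bound[OF assms(1)])
  moreover have "inner (grad f x) g = ((norm (grad f x))\<^sup>2 + (norm g)\<^sup>2 - (norm (g - grad f x))\<^sup>2) / 2"
    by (simp add: power2_norm_eq_inner inner_diff_left inner_diff_right inner_commute)
  ultimately show ?thesis using assms(2)
    by (simp add: field_simps)
qed

subsection \<open>Independent sums and kernels\<close>

text \<open>When the square is expanded, the cross term has mean zero because
  \<open>X - \<mu>\<close> is centred. In the sums below, the shift \<open>a\<close> collects the
  terms that are held fixed.\<close>

lemma nn_integral_norm_sq_shift_le:
  fixes X :: "'b \<Rightarrow> 'a::euclidean_space"
  assumes "prob_space M" and X: "has_bochner_integral M X \<mu>"
    and v: "(\<integral>\<^sup>+ \<omega>. ennreal ((norm (X \<omega> - \<mu>))\<^sup>2) \<partial>M) \<le> ennreal v" and "0 \<le> v"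
  shows "(\<integral>\<^sup>+ \<omega>. ennreal ((norm (a + c *\<^sub>R (X \<omega> - \<mu>)))\<^sup>2) \<partial>M) \<le> ennreal ((norm a)\<^sup>2 + c\<^sup>2 * v)"
proof -
  interpret prob_space M by fact
  have iX: "integrable M X" and eX: "integral\<^sup>L M X = \<mu>"
    using X by (auto simp: has_bochner_integral_iff)
  have [measurable]: "X \<in> borel_measurable M" using iX by auto
  \<comment> \<open>The finite bound on the second moment gives integrability, so that the expansion
    can be computed with Bochner integrals.\<close>
  have i2: "integrable M (\<lambda>\<omega>. (norm (X \<omega> - \<mu>))\<^sup>2)"
    using v by (intro integrableI_bounded) (auto simp: le_less_trans)
  have e2: "(\<integral>\<omega>. (norm (X \<omega> - \<mu>))\<^sup>2 \<partial>M) \<le> v"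
    using v \<open>0 \<le> v\<close> i2 by (subst (asm) nn_integral_eq_integral) auto
  have eq: "(norm (a + c *\<^sub>R (X \<omega> - \<mu>)))\<^sup>2
      = (norm a)\<^sup>2 + 2 * c * inner (X \<omega> - \<mu>) a + c\<^sup>2 * (norm (X \<omega> - \<mu>))\<^sup>2" for \<omega>
    by (simp only: power2_norm_eq_inner inner_add_left inner_add_right inner_scaleR_left inner_scaleR_right)
      (simp add: inner_commute power2_eq_square algebra_simps del: inner_diff_left inner_diff_right)
  have i1: "integrable M (\<lambda>\<omega>. inner (X \<omega> - \<mu>) a)" using iX by simp
  have e1: "(\<integral>\<omega>. inner (X \<omega> - \<mu>) a \<partial>M) = 0"
    using iX eX by (simp add: prob_space)
  have "(\<integral>\<^sup>+ \<omega>. ennreal ((norm (a + c *\<^sub>R (X \<omega> - \<mu>)))\<^sup>2) \<partial>M)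
      = ennreal (\<integral>\<omega>. (norm (a + c *\<^sub>R (X \<omega> - \<mu>)))\<^sup>2 \<partial>M)"
    using i1 i2 by (intro nn_integral_eq_integral AE_I2 zero_le_power2) (simp add: eq)
  also have "(\<integral>\<omega>. (norm (a + c *\<^sub>R (X \<omega> - \<mu>)))\<^sup>2 \<partial>M)
      = (norm a)\<^sup>2 + c\<^sup>2 * (\<integral>\<omega>. (norm (X \<omega> - \<mu>))\<^sup>2 \<partial>M)"
    unfolding eq using i1 i2 e1 by (simp add: prob_space)
  also have "ennreal \<dots> \<le> ennreal ((norm a)\<^sup>2 + c\<^sup>2 * v)"
    using e2 by (intro ennreal_leI add_left_mono mult_left_mono) auto
  finally show ?thesis .
qed

text \<open>The variance is the second moment minus the squared norm of the mean.\<close>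

lemma nn_integral_norm_sq_centered_le:
  fixes X :: "'b \<Rightarrow> 'a::euclidean_space"
  assumes "prob_space M" and X: "has_bochner_integral M X \<mu>"
    and v: "(\<integral>\<^sup>+ \<omega>. ennreal ((norm (X \<omega>))\<^sup>2) \<partial>M) \<le> ennreal v" and "0 \<le> v"
  shows "(\<integral>\<^sup>+ \<omega>. ennreal ((norm (X \<omega> - \<mu>))\<^sup>2) \<partial>M) \<le> ennreal v"
proof -
  interpret prob_space M by fact
  have iX: "integrable M X" and eX: "integral\<^sup>L M X = \<mu>"
    using X by (auto simp: has_bochner_integral_iff)
  have [measurable]: "X \<in> borel_measurable M" using iX by auto
  have i2: "integrable M (\<lambda>\<omega>. (norm (X \<omega>))\<^sup>2)"
    using v by (intro integrableI_bounded) (auto simp: le_less_trans)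
  have e2: "(\<integral>\<omega>. (norm (X \<omega>))\<^sup>2 \<partial>M) \<le> v"
    using v \<open>0 \<le> v\<close> i2 by (subst (asm) nn_integral_eq_integral) auto
  have eq: "(norm (X \<omega> - \<mu>))\<^sup>2 = (norm (X \<omega>))\<^sup>2 - 2 * inner (X \<omega>) \<mu> + (norm \<mu>)\<^sup>2" for \<omega>
    by (simp add: power2_norm_eq_inner inner_diff_left inner_diff_right inner_commute)
  have i1: "integrable M (\<lambda>\<omega>. inner (X \<omega>) \<mu>)" using iX by simp
  have "(\<integral>\<^sup>+ \<omega>. ennreal ((norm (X \<omega> - \<mu>))\<^sup>2) \<partial>M) = ennreal (\<integral>\<omega>. (norm (X \<omega> - \<mu>))\<^sup>2 \<partial>M)"
    using i1 i2 by (intro nn_integral_eq_integral AE_I2 zero_le_power2) (simp add: eq)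
  also have "(\<integral>\<omega>. (norm (X \<omega> - \<mu>))\<^sup>2 \<partial>M) = (\<integral>\<omega>. (norm (X \<omega>))\<^sup>2 \<partial>M) - (norm \<mu>)\<^sup>2"
    unfolding eq using i1 i2 iX eX by (simp add: prob_space power2_norm_eq_inner)
  also have "ennreal \<dots> \<le> ennreal v"
    using e2 by (intro ennreal_leI) (simp add: add_increasing2 diff_le_eq)
  finally show ?thesis .
qed

lemma nn_integral_PiM_lessThan_Suc:
  fixes M :: "nat \<Rightarrow> 'a measure"
  assumes "\<And>j. prob_space (M j)" and [measurable]: "h \<in> borel_measurable (PiM {..<Suc r} M)"
  shows "(\<integral>\<^sup>+ m. h m \<partial>PiM {..<Suc r} M) = (\<integral>\<^sup>+ m. \<integral>\<^sup>+ y. h (m(r := y)) \<partial>M r \<partial>PiM {..<r} M)"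
proof -
  interpret product_sigma_finite M
    using assms(1) by (intro product_sigma_finite.intro prob_space_imp_sigma_finite)
  show ?thesis
    using product_nn_integral_insert[of "{..<r}" r h] assms(2) by (simp add: lessThan_Suc)
qed

text \<open>Independence enters through Fubini: the last coordinate is integrated first while the
  others act as a fixed shift, so cross terms disappear and variances add.\<close>

lemma nn_integral_PiM_norm_sq_sum_le:
  fixes M :: "nat \<Rightarrow> 'a::euclidean_space measure"
  assumes M: "\<And>j. prob_space (M j)" and [measurable_cong]: "\<And>j. sets (M j) = sets borel"
    and \<mu>: "\<And>j. has_bochner_integral (M j) (\<lambda>y. y) (\<mu> j)"
    and v: "\<And>j. (\<integral>\<^sup>+ y. ennreal ((norm (y - \<mu> j))\<^sup>2) \<partial>M j) \<le> ennreal (v j)" "\<And>j. 0 \<le> v j"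
  shows "(\<integral>\<^sup>+ m. ennreal ((norm (a + c *\<^sub>R (\<Sum>j<r. m j - \<mu> j)))\<^sup>2) \<partial>PiM {..<r} M)
    \<le> ennreal ((norm a)\<^sup>2 + c\<^sup>2 * (\<Sum>j<r. v j))"
proof (induction r)
  case 0
  interpret prob_space "PiM {} M" using M by (intro prob_space_PiM)
  show ?case by (simp add: emeasure_space_1)
next
  case (Suc r)
  interpret P: prob_space "PiM {..<r} M" using M by (intro prob_space_PiM)
  have "(\<integral>\<^sup>+ m. ennreal ((norm (a + c *\<^sub>R (\<Sum>j<Suc r. m j - \<mu> j)))\<^sup>2) \<partial>PiM {..<Suc r} M)
    = (\<integral>\<^sup>+ m. \<integral>\<^sup>+ y. ennreal ((norm ((a + c *\<^sub>R (\<Sum>j<r. m j - \<mu> j)) + c *\<^sub>R (y - \<mu> r)))\<^sup>2) \<partial>M r \<partial>PiM {..<r} M)"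
    by (subst nn_integral_PiM_lessThan_Suc[OF M]) (simp_all add: scaleR_add_right add.assoc cong: sum.cong_simp)
  also have "\<dots> \<le> (\<integral>\<^sup>+ m. ennreal ((norm (a + c *\<^sub>R (\<Sum>j<r. m j - \<mu> j)))\<^sup>2 + c\<^sup>2 * v r) \<partial>PiM {..<r} M)"
    by (intro nn_integral_mono nn_integral_norm_sq_shift_le M \<mu> v)
  also have "\<dots> = (\<integral>\<^sup>+ m. ennreal ((norm (a + c *\<^sub>R (\<Sum>j<r. m j - \<mu> j)))\<^sup>2) \<partial>PiM {..<r} M) + ennreal (c\<^sup>2 * v r)"
    using v(2) by (simp add: nn_integral_add P.emeasure_space_1)
  also have "\<dots> \<le> ennreal ((norm a)\<^sup>2 + c\<^sup>2 * (\<Sum>j<r. v j)) + ennreal (c\<^sup>2 * v r)"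
    by (intro add_right_mono Suc.IH)
  also have "\<dots> = ennreal ((norm a)\<^sup>2 + c\<^sup>2 * (\<Sum>j<Suc r. v j))"
    using v(2) by (simp add: sum_nonneg algebra_simps flip: ennreal_plus)
  finally show ?case .
qed

lemma nn_integral_PiM_sum:
  fixes M :: "nat \<Rightarrow> 'a measure" and h :: "'a \<Rightarrow> ennreal"
  assumes M: "\<And>j. prob_space (M j)" and [measurable]: "\<And>j. h \<in> borel_measurable (M j)"
  shows "(\<integral>\<^sup>+ m. (\<Sum>j<r. h (m j)) \<partial>PiM {..<r} M) = (\<Sum>j<r. \<integral>\<^sup>+ y. h y \<partial>M j)"
proof -
  have "(\<integral>\<^sup>+ m. h (m j) \<partial>PiM {..<r} M) = (\<integral>\<^sup>+ y. h y \<partial>M j)" if "j < r" for j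
  proof -
    have "(\<integral>\<^sup>+ y. h y \<partial>M j) = (\<integral>\<^sup>+ y. h y \<partial>distr (PiM {..<r} M) (M j) (\<lambda>m. m j))"
      using that M by (subst distr_PiM_component) auto
    then show ?thesis using that by (subst (asm) nn_integral_distr) auto
  qed
  then show ?thesis by (subst nn_integral_sum) auto
qed

section \<open>Sums over i.i.d. sampled indices\<close>

lemma nn_integral_replicate_pmf_Suc:
  "(\<integral>\<^sup>+ I. h I \<partial>replicate_pmf (Suc r) D) = (\<integral>\<^sup>+ i. \<integral>\<^sup>+ I. h (i # I) \<partial>replicate_pmf r D \<partial>D)"
  by simp

text \<open>The counterpart of \<open>nn_integral_PiM_norm_sq_sum_le\<close> for sampled lists.
  These are peeled at the head, whose summand moves into the shift; hence the induction generalizes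
  \<open>a\<close>.\<close>

lemma nn_integral_replicate_pmf_norm_sq_sum_le:
  fixes X :: "'b \<Rightarrow> 'a::euclidean_space"
  assumes X: "has_bochner_integral (measure_pmf D) X \<mu>"
    and v: "(\<integral>\<^sup>+ i. ennreal ((norm (X i - \<mu>))\<^sup>2) \<partial>D) \<le> ennreal v" "0 \<le> v"
  shows "(\<integral>\<^sup>+ I. ennreal ((norm (a + c *\<^sub>R (\<Sum>j<r. X (I ! j) - \<mu>)))\<^sup>2) \<partial>replicate_pmf r D)
    \<le> ennreal ((norm a)\<^sup>2 + c\<^sup>2 * (real r * v))"
proof (induction r arbitrary: a)
  case (Suc r)
  have "(\<integral>\<^sup>+ I. ennreal ((norm (a + c *\<^sub>R (\<Sum>j<Suc r. X (I ! j) - \<mu>)))\<^sup>2) \<partial>replicate_pmf (Suc r) D)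
    = (\<integral>\<^sup>+ i. \<integral>\<^sup>+ I. ennreal ((norm ((a + c *\<^sub>R (X i - \<mu>)) + c *\<^sub>R (\<Sum>j<r. X (I ! j) - \<mu>)))\<^sup>2)
        \<partial>replicate_pmf r D \<partial>D)"
    unfolding nn_integral_replicate_pmf_Suc by (simp add: sum.lessThan_Suc_shift scaleR_add_right add.assoc del: sum.lessThan_Suc)
  also have "\<dots> \<le> (\<integral>\<^sup>+ i. ennreal ((norm (a + c *\<^sub>R (X i - \<mu>)))\<^sup>2 + c\<^sup>2 * (real r * v)) \<partial>D)"
    by (intro nn_integral_mono Suc.IH)
  also have "\<dots> = (\<integral>\<^sup>+ i. ennreal ((norm (a + c *\<^sub>R (X i - \<mu>)))\<^sup>2) \<partial>D) + ennreal (c\<^sup>2 * (real r * v))"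
    using v(2) by (simp add: nn_integral_add)
  also have "\<dots> \<le> ennreal ((norm a)\<^sup>2 + c\<^sup>2 * v) + ennreal (c\<^sup>2 * (real r * v))"
    by (intro add_right_mono nn_integral_norm_sq_shift_le X v prob_space_measure_pmf)
  also have "\<dots> = ennreal ((norm a)\<^sup>2 + c\<^sup>2 * (real (Suc r) * v))"
    using v(2) by (simp add: algebra_simps flip: ennreal_plus)
  finally show ?case .
qed simp

lemma nn_integral_replicate_pmf_sum:
  fixes h :: "'b \<Rightarrow> ennreal"
  shows "(\<integral>\<^sup>+ I. (\<Sum>j<r. h (I ! j)) \<partial>replicate_pmf r D) = of_nat r * (\<integral>\<^sup>+ i. h i \<partial>D)"
proof (induction r)
  case (Suc r)
  then show ?case
    unfolding nn_integral_replicate_pmf_Suc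
    by (simp add: sum.lessThan_Suc_shift nn_integral_add algebra_simps del: sum.lessThan_Suc)
qed simp

section \<open>Measurability of product kernels and of mixtures\<close>

lemma measurable_PiM_prob_algebra:
  assumes "finite I" and "\<And>i. i \<in> I \<Longrightarrow> K i \<in> M \<rightarrow>\<^sub>M prob_algebra (N i)"
  shows "(\<lambda>x. PiM I (\<lambda>i. K i x)) \<in> M \<rightarrow>\<^sub>M prob_algebra (PiM I N)"
proof -
  have K: "prob_space (K i x)" "sets (K i x) = sets (N i)" if "i \<in> I" "x \<in> space M" for i x
    using measurable_space[OF assms(2)[OF that(1)] that(2)] by (auto simp: space_prob_algebra)
  show ?thesis
  \<comment> \<open>It suffices to check the boxes of \<open>prod_algebra\<close>, an
    intersection-stable generator; there the measure is a finite product of measurable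
    functions.\<close>
  proof (rule measurable_prob_algebra_generated[OF sets_PiM Int_stable_prod_algebra prod_algebra_sets_into_space])
    fix x assume x: "x \<in> space M"
    show "prob_space (PiM I (\<lambda>i. K i x))" using K x by (intro prob_space_PiM)
    show "sets (PiM I (\<lambda>i. K i x)) = sets (PiM I N)" using K x by (intro sets_PiM_cong) auto
  next
    fix A assume "A \<in> prod_algebra I N"
    then obtain E where A: "A = Pi\<^sub>E I E" and E: "E \<in> (\<Pi> i\<in>I. sets (N i))"
      by (rule prod_algebraE_all)
    have "emeasure (PiM I (\<lambda>i. K i x)) A = (\<Prod>i\<in>I. emeasure (K i x) (E i))" if x: "x \<in> space M" for x
    proof -
      \<comment> \<open>\<open>product_sigma_finite\<close> speaks about all indices, also those
        outside \<open>I\<close>. There a Dirac measure is put, which leaves the product over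
        \<open>I\<close> unchanged.\<close>
      define K' where "K' i = (if i \<in> I then K i x else return (count_space UNIV) undefined)" for i
      have "prob_space (K' i)" for i using K x by (auto simp: K'_def prob_space_return)
      then interpret product_sigma_finite K'
        by (intro product_sigma_finite.intro prob_space_imp_sigma_finite)
      have "PiM I (\<lambda>i. K i x) = PiM I K'" by (intro PiM_cong) (auto simp: K'_def)
      then show ?thesis unfolding A
        using E K x \<open>finite I\<close> by (simp add: emeasure_PiM K'_def Pi_iff)
    qed
    moreover have "(\<lambda>x. \<Prod>i\<in>I. emeasure (K i x) (E i)) \<in> borel_measurable M"
      using assms(2) E
      by (intro borel_measurable_prod_ennreal measurable_emeasure_kernel[of _ _ "N i" for i] measurable_prob_algebraD)
        (auto simp: Pi_iff)
    ultimately show "(\<lambda>x. emeasure (PiM I (\<lambda>i. K i x)) A) \<in> borel_measurable M"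
      by (subst measurable_cong) auto
  qed
qed

text \<open>Countability of the index type allows joint measurability to be checked for each fixed
  index. Coins and lists of sampled workers both have countable type.\<close>

lemma measurable_bind_pmf_prob_algebra:
  fixes D :: "'b::countable pmf"
  assumes "\<And>i. K i \<in> M \<rightarrow>\<^sub>M prob_algebra N"
  shows "(\<lambda>x. measure_pmf D \<bind> (\<lambda>i. K i x)) \<in> M \<rightarrow>\<^sub>M prob_algebra N"
proof (rule measurable_bind_prob_space2)
  show "(\<lambda>x. measure_pmf D) \<in> M \<rightarrow>\<^sub>M prob_algebra (count_space UNIV)"
    by (intro measurable_const) (auto simp: space_prob_algebra prob_space_measure_pmf)
  show "(\<lambda>(x, i). K i x) \<in> M \<Otimes>\<^sub>M count_space UNIV \<rightarrow>\<^sub>M prob_algebra N"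
    by (subst measurable_pair_swap_iff, rule measurable_pair_measure_countable1) (use assms in auto)
qed

subsection \<open>One step of PP-MARINA as a Markov kernel\<close>

lemma nnz_measurable [measurable]: "(nnz :: real ^ 'd::finite \<Rightarrow> nat) \<in> borel \<rightarrow>\<^sub>M count_space UNIV"
proof -
  have "nnz = (\<lambda>y::real^'d. \<Sum>j\<in>UNIV. if y $ j \<noteq> 0 then 1 else 0)"
    by (auto simp: nnz_def fun_eq_iff sum.If_cases)
  moreover have "(\<lambda>y::real^'d. \<Sum>j\<in>UNIV. if y $ j \<noteq> 0 then 1 else 0 :: nat) \<in> borel \<rightarrow>\<^sub>M count_space UNIV"
    by measurable
  ultimately show ?thesis by simp
qed

lemma nnz_le: "nnz (y :: real ^ 'd::finite) \<le> CARD('d)"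
  unfolding nnz_def by (intro card_mono) auto

text \<open>Given the coin and the messages, a round is deterministic. \<open>sync_state\<close> and
  \<open>compressed_state\<close> isolate that part, so the random step becomes a mixture of image
  measures under these maps.\<close>

definition sync_state ::
  "nat \<Rightarrow> (nat \<Rightarrow> real ^ 'd \<Rightarrow> real) \<Rightarrow> real \<Rightarrow> 'd::finite state \<Rightarrow> 'd state" where
  "sync_state n f \<gamma> s = (let x' = fst s - \<gamma> *\<^sub>R fst (snd s) in
     (x', grad (objective n f) x', snd (snd s) + (\<Sum>i=1..n. nnz (grad (f i) x'))))"

definition compressed_state ::
  "real \<Rightarrow> nat \<Rightarrow> 'd::finite state \<Rightarrow> (nat \<Rightarrow> real ^ 'd) \<Rightarrow> 'd state" where
  "compressed_state \<gamma> r s m =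
     (fst s - \<gamma> *\<^sub>R fst (snd s), fst (snd s) + (1 / real r) *\<^sub>R (\<Sum>j<r. m j), snd (snd s) + (\<Sum>j<r. nnz (m j)))"

definition grad_change ::
  "(nat \<Rightarrow> real ^ 'd \<Rightarrow> real) \<Rightarrow> real \<Rightarrow> nat \<Rightarrow> 'd::finite state \<Rightarrow> real ^ 'd" where
  "grad_change f \<gamma> i s = grad (f i) (fst s - \<gamma> *\<^sub>R fst (snd s)) - grad (f i) (fst s)"

lemma pp_marina_step_eq:
  "pp_marina_step n f Q \<gamma> p r s =
     measure_pmf (bernoulli_pmf p) \<bind> (\<lambda>c. if c then return state_space (sync_state n f \<gamma> s)
       else measure_pmf (replicate_pmf r (pmf_of_set {1..n})) \<bind> (\<lambda>I.
         PiM {..<r} (\<lambda>j. Q (grad_change f \<gamma> (I ! j) s)) \<bind> (\<lambda>m.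
           return state_space (compressed_state \<gamma> r s m))))"
  unfolding pp_marina_step_def sync_state_def compressed_state_def grad_change_def Let_def split_beta by (rule refl)

lemma compressed_state_measurable:
  "(\<lambda>(s, m). compressed_state \<gamma> r s m) \<in> state_space \<Otimes>\<^sub>M PiM {..<r} (\<lambda>_. borel) \<rightarrow>\<^sub>M state_space"
  unfolding compressed_state_def by measurable

lemma compressed_state_measurable_message [measurable]:
  "compressed_state \<gamma> r s \<in> PiM {..<r} (\<lambda>_. borel) \<rightarrow>\<^sub>M state_space"
  unfolding compressed_state_def by measurable

lemma quantizationD:
  assumes "quantization \<omega> Q"
  shows "0 < \<omega>" "Q \<in> borel \<rightarrow>\<^sub>M prob_algebra borel" "prob_space (Q x)" "sets (Q x) = sets borel"
    "has_bochner_integral (Q x) (\<lambda>y. y) x"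
    "(\<integral>\<^sup>+ y. ennreal ((norm (y - x))\<^sup>2) \<partial>Q x) \<le> ennreal (\<omega> * (norm x)\<^sup>2)"
proof -
  show Q: "Q \<in> borel \<rightarrow>\<^sub>M prob_algebra borel" using assms by (simp add: quantization_def)
  show "prob_space (Q x)" "sets (Q x) = sets borel"
    using measurable_space[OF Q, of x] by (auto simp: space_prob_algebra)
qed (use assms in \<open>simp_all add: quantization_def\<close>)

lemma prob_algebra_subset: "space (prob_algebra M) \<subseteq> space (subprob_algebra M)"
  by (auto simp: space_prob_algebra space_subprob_algebra prob_space_imp_subprob_space)

text \<open>Binding with \<open>return\<close> amounts to taking an image measure. The vectors
  \<open>v\<close> are arbitrary, so the lemma also serves where no measurability of gradients is
  known.\<close>

lemma compressed_round_in_prob_algebra: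
  assumes "quantization \<omega> Q"
  shows "PiM {..<r} (\<lambda>j. Q (v j)) \<bind> (\<lambda>m. return state_space (compressed_state \<gamma> r s m))
    \<in> space (prob_algebra state_space)"
proof -
  note [measurable_cong] = quantizationD(4)[OF assms]
  interpret prob_space "PiM {..<r} (\<lambda>j. Q (v j))"
    using quantizationD(3)[OF assms] by (rule prob_space_PiM)
  have "compressed_state \<gamma> r s \<in> PiM {..<r} (\<lambda>j. Q (v j)) \<rightarrow>\<^sub>M state_space" by measurable
  then show ?thesis
    using not_empty
    by (subst bind_return_distr') (simp_all add: space_prob_algebra prob_space_distr)
qed

text \<open>Every list in the support of the sampling law has \<open>r\<close> entries, all in
  \<open>{1..n}\<close>, so values of \<open>f\<close> at other indices never enter.\<close>

lemma pp_marina_step_cong: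
  assumes Q: "quantization \<omega> Q" and "1 \<le> n" and eq: "\<And>i. i \<in> {1..n} \<Longrightarrow> f i = f' i"
  shows "pp_marina_step n f Q \<gamma> p r = pp_marina_step n f' Q \<gamma> p r"
proof
  fix s
  have obj: "objective n f = objective n f'" by (simp add: objective_def fun_eq_iff eq)
  have sync: "sync_state n f \<gamma> s = sync_state n f' \<gamma> s" by (simp add: sync_state_def obj eq)
  have K: "PiM {..<r} (\<lambda>j. Q (v j)) \<bind> (\<lambda>m. return state_space (compressed_state \<gamma> r s m))
      \<in> space (subprob_algebra state_space)" for v
    using compressed_round_in_prob_algebra[OF Q, THEN subsetD[OF prob_algebra_subset]] .
  have "measure_pmf (replicate_pmf r (pmf_of_set {1..n})) \<bind> (\<lambda>I.
         PiM {..<r} (\<lambda>j. Q (grad_change f \<gamma> (I ! j) s)) \<bind> (\<lambda>m. return state_space (compressed_state \<gamma> r s m)))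
      = measure_pmf (replicate_pmf r (pmf_of_set {1..n})) \<bind> (\<lambda>I.
         PiM {..<r} (\<lambda>j. Q (grad_change f' \<gamma> (I ! j) s)) \<bind> (\<lambda>m. return state_space (compressed_state \<gamma> r s m)))"
  proof (rule bind_measure_pmf_cong[where N = state_space])
    fix I assume "I \<in> set_pmf (replicate_pmf r (pmf_of_set {1..n}))"
    then have "I ! j \<in> {1..n}" if "j < r" for j
      using that \<open>1 \<le> n\<close> nth_mem[of j I] by (auto simp: set_replicate_pmf)
    then have "PiM {..<r} (\<lambda>j. Q (grad_change f \<gamma> (I ! j) s)) = PiM {..<r} (\<lambda>j. Q (grad_change f' \<gamma> (I ! j) s))"
      by (intro PiM_cong) (simp_all add: grad_change_def eq)
    then show "PiM {..<r} (\<lambda>j. Q (grad_change f \<gamma> (I ! j) s)) \<bind> (\<lambda>m. return state_space (compressed_state \<gamma> r s m))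
        = PiM {..<r} (\<lambda>j. Q (grad_change f' \<gamma> (I ! j) s)) \<bind> (\<lambda>m. return state_space (compressed_state \<gamma> r s m))"
      by simp
  qed (rule K)+
  then show "pp_marina_step n f Q \<gamma> p r s = pp_marina_step n f' Q \<gamma> p r s"
    by (simp only: pp_marina_step_eq sync)
qed

lemma pp_marina_cong:
  assumes "quantization \<omega> Q" and "1 \<le> n" and eq: "\<And>i. i \<in> {1..n} \<Longrightarrow> f i = f' i"
  shows "pp_marina n f Q \<gamma> p r x0 k = pp_marina n f' Q \<gamma> p r x0 k"
proof (induction k)
  case 0
  have "objective n f = objective n f'" by (simp add: objective_def fun_eq_iff eq)
  then show ?case by (simp add: eq)
next
  case (Suc k)
  have "pp_marina_step n f Q \<gamma> p r = pp_marina_step n f' Q \<gamma> p r"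
    using assms by (rule pp_marina_step_cong)
  then show ?case using Suc by simp
qed

text \<open>Smoothness is assumed at every natural index because the kernels are indexed by
  arbitrary lists. \<open>p\<close> and \<open>\<gamma>\<close> stay general; relations that tie
  them to the other parameters are hypotheses of the lemmas that use them.\<close>

locale smooth_marina =
  fixes n r :: nat and f :: "nat \<Rightarrow> real ^ 'd::finite \<Rightarrow> real" and Ls :: "nat \<Rightarrow> real"
    and Q :: "real ^ 'd \<Rightarrow> (real ^ 'd) measure" and \<omega> \<gamma> p :: real
  assumes n: "1 \<le> n" and r: "1 \<le> r" and sm: "\<And>i. smooth (Ls i) (f i)"
    and Q: "quantization \<omega> Q" and p: "0 < p" "p \<le> 1" and \<gamma>: "0 < \<gamma>"
begin

abbreviation F where "F \<equiv> objective n f"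

definition L where "L = sqrt ((1 / real n) * (\<Sum>i=1..n. (Ls i)\<^sup>2))"

lemma smooth_F: "smooth L F"
  unfolding L_def using sm by (rule smooth_objective)

lemma L_sq: "L\<^sup>2 = (1 / real n) * (\<Sum>i=1..n. (Ls i)\<^sup>2)"
  by (simp add: L_def sum_nonneg)

lemma grad_F: "grad F x = (1 / real n) *\<^sub>R (\<Sum>i=1..n. grad (f i) x)"
  using sm by (rule grad_objective)

lemma grad_f_measurable [measurable]: "grad (f i) \<in> borel_measurable borel"
  using smooth_continuous_grad[OF sm] by (rule borel_measurable_continuous_onI)

lemma grad_F_measurable [measurable]: "grad F \<in> borel_measurable borel"
  using smooth_continuous_grad[OF smooth_F] by (rule borel_measurable_continuous_onI)

lemma F_measurable [measurable]: "F \<in> borel_measurable borel"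
  using smooth_F unfolding smooth_def
  by (intro borel_measurable_continuous_onI continuous_at_imp_continuous_on)
    (auto intro: differentiable_imp_continuous_within)

lemma sync_state_measurable [measurable]: "sync_state n f \<gamma> \<in> state_space \<rightarrow>\<^sub>M state_space"
  unfolding sync_state_def Let_def by measurable

lemma grad_change_measurable [measurable]: "grad_change f \<gamma> i \<in> state_space \<rightarrow>\<^sub>M borel"
  unfolding grad_change_def by measurable

text \<open>The kernel is assembled from the inside out: independent quantizations, deterministic
  update, mixture over sampled lists, mixture over the coin.\<close>

lemma step_measurable: "pp_marina_step n f Q \<gamma> p r \<in> state_space \<rightarrow>\<^sub>M prob_algebra state_space"
proof -
  have "(\<lambda>s. PiM {..<r} (\<lambda>j. Q (grad_change f \<gamma> (I ! j) s))) \<in> state_space \<rightarrow>\<^sub>M prob_algebra (PiM {..<r} (\<lambda>_. borel))" for I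
    using measurable_compose[OF grad_change_measurable quantizationD(2)[OF Q]]
    by (intro measurable_PiM_prob_algebra) auto
  moreover have "(\<lambda>(s, m). return state_space (compressed_state \<gamma> r s m))
      \<in> state_space \<Otimes>\<^sub>M PiM {..<r} (\<lambda>_. borel) \<rightarrow>\<^sub>M prob_algebra state_space"
    using measurable_compose[OF compressed_state_measurable measurable_return_prob_space]
    by (simp add: split_beta')
  ultimately have "(\<lambda>s. PiM {..<r} (\<lambda>j. Q (grad_change f \<gamma> (I ! j) s)) \<bind>
      (\<lambda>m. return state_space (compressed_state \<gamma> r s m))) \<in> state_space \<rightarrow>\<^sub>M prob_algebra state_space" for I
    by (rule measurable_bind_prob_space2)
  then have I: "(\<lambda>s. measure_pmf (replicate_pmf r (pmf_of_set {1..n})) \<bind> (\<lambda>I.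
      PiM {..<r} (\<lambda>j. Q (grad_change f \<gamma> (I ! j) s)) \<bind> (\<lambda>m. return state_space (compressed_state \<gamma> r s m))))
      \<in> state_space \<rightarrow>\<^sub>M prob_algebra state_space"
    by (rule measurable_bind_pmf_prob_algebra)
  have "(\<lambda>s. if c then return state_space (sync_state n f \<gamma> s) else
      measure_pmf (replicate_pmf r (pmf_of_set {1..n})) \<bind> (\<lambda>I.
      PiM {..<r} (\<lambda>j. Q (grad_change f \<gamma> (I ! j) s)) \<bind> (\<lambda>m. return state_space (compressed_state \<gamma> r s m))))
      \<in> state_space \<rightarrow>\<^sub>M prob_algebra state_space" for c
    using I measurable_compose[OF sync_state_measurable measurable_return_prob_space] by (cases c) auto
  then show ?thesis unfolding pp_marina_step_eq[abs_def] by (rule measurable_bind_pmf_prob_algebra)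
qed

text \<open>Both one-step estimates start from this formula, with \<open>h\<close> the communication
  count and with \<open>h\<close> the potential.\<close>

lemma nn_integral_step:
  assumes h: "h \<in> borel_measurable state_space"
  shows "(\<integral>\<^sup>+ t. h t \<partial>pp_marina_step n f Q \<gamma> p r s) = h (sync_state n f \<gamma> s) * p +
    (\<integral>\<^sup>+ I. \<integral>\<^sup>+ m. h (compressed_state \<gamma> r s m) \<partial>PiM {..<r} (\<lambda>j. Q (grad_change f \<gamma> (I ! j) s))
       \<partial>replicate_pmf r (pmf_of_set {1..n})) * (1 - p)"
proof -
  define M where "M I = PiM {..<r} (\<lambda>j. Q (grad_change f \<gamma> (I ! j) s))" for I
  let ?R = "\<lambda>I. M I \<bind> (\<lambda>m. return state_space (compressed_state \<gamma> r s m))"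
  let ?S = "measure_pmf (replicate_pmf r (pmf_of_set {1..n}))"
  have R: "?R I \<in> space (prob_algebra state_space)" for I
    unfolding M_def by (rule compressed_round_in_prob_algebra[OF Q])
  then have R': "?R \<in> ?S \<rightarrow>\<^sub>M subprob_algebra state_space"
    using prob_algebra_subset by (auto simp only: measurable_pmf_measure1 Pi_iff)
  have SR: "?S \<bind> ?R \<in> space (prob_algebra state_space)"
  proof -
    \<comment> \<open>A single measure is viewed as a kernel on the one-point space, so that the
      mixture lemma for kernels applies.\<close>
    have "(\<lambda>_::unit. ?S \<bind> ?R) \<in> count_space UNIV \<rightarrow>\<^sub>M prob_algebra state_space"
      by (rule measurable_bind_pmf_prob_algebra) (rule measurable_const[OF R])
    from measurable_space[OF this] show ?thesis by simp
  qed
  have i1: "(\<integral>\<^sup>+ t. h t \<partial>?R I) = (\<integral>\<^sup>+ m. h (compressed_state \<gamma> r s m) \<partial>M I)" for I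
  proof -
    have sets: "sets (M I) = sets (PiM {..<r} (\<lambda>_. borel))"
      unfolding M_def using quantizationD(4)[OF Q] by (intro sets_PiM_cong) auto
    have cs: "compressed_state \<gamma> r s \<in> M I \<rightarrow>\<^sub>M state_space"
      unfolding measurable_cong_sets[OF sets refl] by (rule compressed_state_measurable_message)
    have "(\<integral>\<^sup>+ t. h t \<partial>?R I) = (\<integral>\<^sup>+ m. \<integral>\<^sup>+ t. h t \<partial>return state_space (compressed_state \<gamma> r s m) \<partial>M I)"
      using h by (intro nn_integral_bind[where B = state_space]
          measurable_compose[OF cs return_measurable])
    then show ?thesis using h by (simp add: nn_integral_return space_pair_measure)
  qed
  have i2: "(\<integral>\<^sup>+ t. h t \<partial>(?S \<bind> ?R)) = (\<integral>\<^sup>+ I. \<integral>\<^sup>+ m. h (compressed_state \<gamma> r s m) \<partial>M I \<partial>?S)"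
    unfolding nn_integral_bind[OF h R'] i1 ..
  have sync: "return state_space (sync_state n f \<gamma> s) \<in> space (prob_algebra state_space)"
    by (simp add: space_prob_algebra prob_space_return space_pair_measure)
  have K: "(\<lambda>c. if c then return state_space (sync_state n f \<gamma> s) else ?S \<bind> ?R)
      \<in> measure_pmf (bernoulli_pmf p) \<rightarrow>\<^sub>M subprob_algebra state_space"
    unfolding measurable_pmf_measure1
    by (rule Pi_I) (simp only: subsetD[OF prob_algebra_subset SR] subsetD[OF prob_algebra_subset sync] simp_thms split: if_split)
  have "(\<integral>\<^sup>+ t. h t \<partial>pp_marina_step n f Q \<gamma> p r s)
      = (\<integral>\<^sup>+ c. \<integral>\<^sup>+ t. h t \<partial>(if c then return state_space (sync_state n f \<gamma> s) else ?S \<bind> ?R) \<partial>bernoulli_pmf p)"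
    unfolding pp_marina_step_eq M_def[symmetric] by (rule nn_integral_bind[OF h K])
  also have "\<dots> = (\<integral>\<^sup>+ t. h t \<partial>return state_space (sync_state n f \<gamma> s)) * p + (\<integral>\<^sup>+ t. h t \<partial>(?S \<bind> ?R)) * (1 - p)"
    using p by (subst nn_integral_bernoulli_pmf) simp_all
  also have "(\<integral>\<^sup>+ t. h t \<partial>return state_space (sync_state n f \<gamma> s)) = h (sync_state n f \<gamma> s)"
    using h by (simp add: nn_integral_return space_pair_measure)
  also note i2
  finally show ?thesis unfolding M_def .
qed

section \<open>The law of the state after finitely many rounds\<close>

lemma pp_marina_in_prob_algebra: "pp_marina n f Q \<gamma> p r x0 k \<in> space (prob_algebra state_space)"
proof (induction k)
  case (Suc k)
  then show ?case
    using prob_space_bind'[OF Suc step_measurable] sets_bind'[OF Suc step_measurable]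
    by (simp add: space_prob_algebra)
qed (simp add: space_prob_algebra prob_space_return space_pair_measure)

lemma sets_pp_marina [measurable_cong]: "sets (pp_marina n f Q \<gamma> p r x0 k) = sets state_space"
  using pp_marina_in_prob_algebra by (simp add: space_prob_algebra)

lemma prob_space_pp_marina: "prob_space (pp_marina n f Q \<gamma> p r x0 k)"
  using pp_marina_in_prob_algebra by (simp add: space_prob_algebra)

lemma nn_integral_pp_marina_Suc:
  assumes "h \<in> borel_measurable state_space"
  shows "(\<integral>\<^sup>+ t. h t \<partial>pp_marina n f Q \<gamma> p r x0 (Suc k))
    = (\<integral>\<^sup>+ s. \<integral>\<^sup>+ t. h t \<partial>pp_marina_step n f Q \<gamma> p r s \<partial>pp_marina n f Q \<gamma> p r x0 k)"
  unfolding pp_marina.simps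
  by (rule nn_integral_bind[OF assms])
    (simp only: measurable_cong_sets[OF sets_pp_marina refl] measurable_prob_algebraD[OF step_measurable])

lemma nn_integral_pp_marina_0:
  assumes "h \<in> borel_measurable state_space"
  shows "(\<integral>\<^sup>+ t. h t \<partial>pp_marina n f Q \<gamma> p r x0 0) = h (x0, grad F x0, \<Sum>i=1..n. nnz (grad (f i) x0))"
  using assms by (simp add: nn_integral_return space_pair_measure)

end

subsection \<open>Communication cost\<close>

text \<open>The bound \<open>nnz_le\<close> makes the supremum in \<open>expected_density\<close> a
  genuine upper bound. Positivity comes from unbiasedness: a law concentrated at zero cannot have a
  nonzero mean.\<close>

lemma quantization_nnz:
  fixes Q :: "real ^ 'd::finite \<Rightarrow> (real ^ 'd) measure"
  assumes Q: "quantization \<omega> Q"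
  shows "integrable (Q x) (\<lambda>y. real (nnz y))"
    and "(\<integral>y. real (nnz y) \<partial>Q x) \<le> expected_density Q"
    and "expected_density Q \<le> real CARD('d)"
    and "0 < expected_density Q"
proof -
  note [measurable_cong] = quantizationD(4)[OF Q]
  have int: "integrable (Q x) (\<lambda>y. real (nnz y))" for x
  proof -
    interpret prob_space "Q x" by (rule quantizationD(3)[OF Q])
    show ?thesis
      by (rule integrable_const_bound[where B = "real CARD('d)"]) (auto simp: nnz_le)
  qed
  have le: "(\<integral>y. real (nnz y) \<partial>Q x) \<le> real CARD('d)" for x
  proof -
    interpret prob_space "Q x" by (rule quantizationD(3)[OF Q])
    show ?thesis using int nnz_le by (intro integral_le_const) auto
  qed
  have ub: "(\<integral>y. real (nnz y) \<partial>Q x) \<le> expected_density Q" for x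
    unfolding expected_density_def using le by (intro cSUP_upper bdd_aboveI2) auto
  show "integrable (Q x) (\<lambda>y. real (nnz y))" by (rule int)
  show "(\<integral>y. real (nnz y) \<partial>Q x) \<le> expected_density Q" by (rule ub)
  show "expected_density Q \<le> real CARD('d)"
    unfolding expected_density_def using le by (intro cSUP_least) auto
  \<comment> \<open>\<open>1\<close> is the all-ones vector; any nonzero vector would do as a
    witness.\<close>
  have "(\<integral>y. real (nnz y) \<partial>Q 1) \<noteq> 0"
  proof
    assume "(\<integral>y. real (nnz y) \<partial>Q 1) = 0"
    then have "AE y in Q 1. real (nnz y) = 0"
      by (subst (asm) integral_nonneg_eq_0_iff_AE[OF int]) auto
    then have "AE y in Q 1. y = 0"
      by eventually_elim (simp add: nnz_def vec_eq_iff)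
    then have "(\<integral>y. y \<partial>Q 1) = (\<integral>y. 0 \<partial>Q 1)" by (intro integral_cong_AE) auto
    moreover have "(\<integral>y. y \<partial>Q 1) = 1"
      using quantizationD(5)[OF Q] by (rule has_bochner_integral_integral_eq)
    ultimately show False by simp
  qed
  moreover have "0 \<le> (\<integral>y. real (nnz y) \<partial>Q 1)" by simp
  ultimately show "0 < expected_density Q" using ub[of 1] by linarith
qed

context smooth_marina
begin

lemma sum_nnz_le: "(\<Sum>i=1..n. nnz (grad (f i) x)) \<le> n * CARD('d)"
  using sum_bounded_above[of "{1..n}" "\<lambda>i. nnz (grad (f i) x)" "CARD('d)"] nnz_le[where 'd = 'd] by simp

text \<open>A synchronization costs at most \<open>d n\<close> and has probability \<open>p\<close>,
  so by \<open>p_eq\<close> it contributes at most \<open>\<zeta> r\<close>. A compressed round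
  costs at most \<open>\<zeta> r\<close> on average, whichever workers are drawn.\<close>

lemma nn_integral_step_cost_le:
  assumes p_eq: "p * (real CARD('d) * real n) = expected_density Q * real r"
  shows "(\<integral>\<^sup>+ t. of_nat (snd (snd t)) \<partial>pp_marina_step n f Q \<gamma> p r s)
    \<le> of_nat (snd (snd s)) + ennreal (2 * expected_density Q * real r)"
proof -
  let ?b = "snd (snd s)" and ?\<zeta> = "expected_density Q" and ?d = "real CARD('d)"
  note \<zeta> = quantization_nnz[OF Q]
  have "real (snd (snd (sync_state n f \<gamma> s))) \<le> real (?b + n * CARD('d))"
    using sum_nnz_le by (simp add: sync_state_def Let_def del: of_nat_add of_nat_mult)
  then have sync: "of_nat (snd (snd (sync_state n f \<gamma> s))) \<le> ennreal (real ?b + real n * ?d)"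
    by (simp add: ennreal_of_nat_eq_real_of_nat ennreal_leI del: ennreal_plus)
  have comp: "(\<integral>\<^sup>+ m. of_nat (snd (snd (compressed_state \<gamma> r s m))) \<partial>PiM {..<r} (\<lambda>j. Q (v j)))
      \<le> ennreal (real ?b + real r * ?\<zeta>)" for v
  proof -
    note [measurable_cong] = quantizationD(4)[OF Q]
    interpret prob_space "PiM {..<r} (\<lambda>j. Q (v j))"
      using quantizationD(3)[OF Q] by (rule prob_space_PiM)
    have Qv: "(\<integral>\<^sup>+ y. of_nat (nnz y) \<partial>Q x) \<le> ennreal ?\<zeta>" for x
      using nn_integral_eq_integral[OF \<zeta>(1)[of x]] \<zeta>(2)[of x]
      by (simp add: ennreal_of_nat_eq_real_of_nat ennreal_leI)
    have "(\<integral>\<^sup>+ m. of_nat (snd (snd (compressed_state \<gamma> r s m))) \<partial>PiM {..<r} (\<lambda>j. Q (v j)))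
      = (\<integral>\<^sup>+ m. of_nat ?b + (\<Sum>j<r. of_nat (nnz (m j))) \<partial>PiM {..<r} (\<lambda>j. Q (v j)))"
      by (simp add: compressed_state_def)
    also have "\<dots> = of_nat ?b + (\<integral>\<^sup>+ m. (\<Sum>j<r. of_nat (nnz (m j))) \<partial>PiM {..<r} (\<lambda>j. Q (v j)))"
      by (subst nn_integral_add) (auto simp: emeasure_space_1)
    also have "(\<integral>\<^sup>+ m. (\<Sum>j<r. of_nat (nnz (m j))) \<partial>PiM {..<r} (\<lambda>j. Q (v j)))
      = (\<Sum>j<r. \<integral>\<^sup>+ y. of_nat (nnz y) \<partial>Q (v j))"
      using quantizationD(3)[OF Q] by (intro nn_integral_PiM_sum) auto
    also have "\<dots> \<le> (\<Sum>j<r. ennreal ?\<zeta>)" by (intro sum_mono Qv)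
    also have "of_nat ?b + (\<Sum>j<r. ennreal ?\<zeta>) = ennreal (real ?b + real r * ?\<zeta>)"
      using \<zeta>(4) by (simp add: ennreal_of_nat_eq_real_of_nat ennreal_mult)
    finally show ?thesis by (simp add: add_left_mono)
  qed
  have I: "(\<integral>\<^sup>+ I. \<integral>\<^sup>+ m. of_nat (snd (snd (compressed_state \<gamma> r s m)))
        \<partial>PiM {..<r} (\<lambda>j. Q (grad_change f \<gamma> (I ! j) s)) \<partial>replicate_pmf r (pmf_of_set {1..n}))
      \<le> ennreal (real ?b + real r * ?\<zeta>)"
    by (rule order_trans[OF nn_integral_mono[OF comp]]) simp
  have "(\<integral>\<^sup>+ t. of_nat (snd (snd t)) \<partial>pp_marina_step n f Q \<gamma> p r s)
      \<le> ennreal (real ?b + real n * ?d) * p + ennreal (real ?b + real r * ?\<zeta>) * (1 - p)"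
    by (subst nn_integral_step, simp, intro add_mono mult_right_mono sync I) simp_all
  also have "\<dots> = ennreal ((real ?b + real n * ?d) * p + (real ?b + real r * ?\<zeta>) * (1 - p))"
    using p \<zeta>(4) by (simp flip: ennreal_plus ennreal_mult)
  also have "\<dots> \<le> ennreal (real ?b + 2 * ?\<zeta> * real r)"
  proof (rule ennreal_leI)
    have "(real ?b + real n * ?d) * p + (real ?b + real r * ?\<zeta>) * (1 - p)
        = real ?b + 2 * ?\<zeta> * real r - real r * ?\<zeta> * p"
      using p_eq by (simp add: algebra_simps)
    moreover have "0 \<le> real r * ?\<zeta> * p" using \<zeta>(4) p by simp
    ultimately show "(real ?b + real n * ?d) * p + (real ?b + real r * ?\<zeta>) * (1 - p)
        \<le> real ?b + 2 * ?\<zeta> * real r" by linarith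
  qed
  also have "\<dots> = of_nat ?b + ennreal (2 * ?\<zeta> * real r)"
    using \<zeta>(4) by (simp add: ennreal_of_nat_eq_real_of_nat)
  finally show ?thesis .
qed

text \<open>The term without \<open>K\<close> pays for the full gradients sent at initialization;
  the rest accumulates the one-step bound.\<close>

lemma expected_cost_le:
  assumes p_eq: "p * (real CARD('d) * real n) = expected_density Q * real r"
  shows "expected_cost n f Q \<gamma> p r x0 K
    \<le> ennreal (real CARD('d) * real n + real K * (2 * expected_density Q * real r))"
proof (induction K)
  case 0
  have "real (\<Sum>i=1..n. nnz (grad (f i) x0)) \<le> real (n * CARD('d))"
    using sum_nnz_le by (rule of_nat_mono)
  then show ?case
    unfolding expected_cost_def
    by (subst nn_integral_pp_marina_0)
      (simp_all add: ennreal_of_nat_eq_real_of_nat mult.commute flip: of_nat_sum)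
next
  case (Suc K)
  define c where "c = 2 * expected_density Q * real r"
  interpret prob_space "pp_marina n f Q \<gamma> p r x0 K" by (rule prob_space_pp_marina)
  have c: "0 \<le> c" using quantization_nnz(4)[OF Q] by (simp add: c_def)
  have "expected_cost n f Q \<gamma> p r x0 (Suc K)
    \<le> (\<integral>\<^sup>+ s. of_nat (snd (snd s)) + ennreal c \<partial>pp_marina n f Q \<gamma> p r x0 K)"
    unfolding expected_cost_def
    by (subst nn_integral_pp_marina_Suc) (auto intro!: nn_integral_mono nn_integral_step_cost_le[OF p_eq, folded c_def])
  also have "\<dots> = expected_cost n f Q \<gamma> p r x0 K + ennreal c"
    unfolding expected_cost_def by (subst nn_integral_add) (auto simp: emeasure_space_1)
  also have "\<dots> \<le> ennreal (real CARD('d) * real n + real K * c) + ennreal c"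
    by (intro add_right_mono Suc.IH[folded c_def])
  also have "\<dots> = ennreal (real CARD('d) * real n + real (Suc K) * c)"
    using c by (simp add: algebra_simps flip: ennreal_plus)
  finally have *: "expected_cost n f Q \<gamma> p r x0 (Suc K) \<le> ennreal (real CARD('d) * real n + real (Suc K) * c)" .
  show ?case using * unfolding c_def by simp
qed

section \<open>Mean and mean square of a sampled gradient change\<close>

lemma has_bochner_integral_grad_change:
  "has_bochner_integral (pmf_of_set {1..n}) (\<lambda>i. grad_change f \<gamma> i s)
     (grad F (fst s - \<gamma> *\<^sub>R fst (snd s)) - grad F (fst s))"
proof -
  have "(\<integral>i. grad_change f \<gamma> i s \<partial>pmf_of_set {1..n}) = (\<Sum>i=1..n. (1 / real n) *\<^sub>R grad_change f \<gamma> i s)"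
    using n by (subst integral_measure_pmf[of "{1..n}"]) auto
  also have "\<dots> = grad F (fst s - \<gamma> *\<^sub>R fst (snd s)) - grad F (fst s)"
    by (simp add: grad_F grad_change_def sum_subtractf scaleR_diff_right scaleR_sum_right)
  finally show ?thesis
    using n by (simp add: has_bochner_integral_iff integrable_measure_pmf_finite)
qed

text \<open>Averaging the individual Lipschitz bounds over a uniformly drawn worker produces the
  mean of the \<open>(Ls i)\<^sup>2\<close>, which is \<open>L\<^sup>2\<close>; the iterate moves by
  \<open>\<gamma>\<close> times the norm of the estimator.\<close>

lemma mean_sq_grad_change_le:
  "(\<integral>\<^sup>+ i. ennreal ((norm (grad_change f \<gamma> i s))\<^sup>2) \<partial>pmf_of_set {1..n})
     \<le> ennreal (L\<^sup>2 * (\<gamma>\<^sup>2 * (norm (fst (snd s)))\<^sup>2))"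
proof -
  let ?g = "fst (snd s)"
  have "(\<Sum>i=1..n. (norm (grad_change f \<gamma> i s))\<^sup>2) \<le> (\<Sum>i=1..n. (Ls i)\<^sup>2 * (\<gamma>\<^sup>2 * (norm ?g)\<^sup>2))"
    using smooth_sq_diff[OF sm, of _ "fst s - \<gamma> *\<^sub>R ?g" "fst s"]
    by (intro sum_mono) (simp add: grad_change_def power_mult_distrib)
  then have "(\<Sum>i=1..n. (norm (grad_change f \<gamma> i s))\<^sup>2) / real n \<le> L\<^sup>2 * (\<gamma>\<^sup>2 * (norm ?g)\<^sup>2)"
    using n unfolding sum_distrib_right[symmetric] by (simp add: L_sq divide_right_mono field_simps)
  moreover have "(\<integral>\<^sup>+ i. ennreal ((norm (grad_change f \<gamma> i s))\<^sup>2) \<partial>pmf_of_set {1..n})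
      = ennreal ((\<Sum>i=1..n. (norm (grad_change f \<gamma> i s))\<^sup>2) / real n)"
    using n by (simp add: nn_integral_pmf_of_set divide_ennreal sum_nonneg ennreal_of_nat_eq_real_of_nat)
  ultimately show ?thesis by (simp add: ennreal_leI)
qed

subsection \<open>Descent of the potential\<close>

text \<open>The new error is the old one plus a sampling deviation plus a compression error.
  Averaging \<open>r\<close> independent draws leaves at most \<open>V s / real r\<close> for the
  former and \<open>\<omega> * V s / real r\<close> for the latter.\<close>

lemma nn_integral_compressed_error_le:
  defines "V s \<equiv> L\<^sup>2 * (\<gamma>\<^sup>2 * (norm (fst (snd s)))\<^sup>2)"
  shows "(\<integral>\<^sup>+ I. \<integral>\<^sup>+ m. ennreal ((norm (fst (snd (compressed_state \<gamma> r s m)) - grad F (fst s - \<gamma> *\<^sub>R fst (snd s))))\<^sup>2)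
        \<partial>PiM {..<r} (\<lambda>j. Q (grad_change f \<gamma> (I ! j) s)) \<partial>replicate_pmf r (pmf_of_set {1..n}))
    \<le> ennreal ((norm (fst (snd s) - grad F (fst s)))\<^sup>2 + (1 + \<omega>) / real r * V s)"
proof -
  define x g where "x = fst s" and "g = fst (snd s)"
  define D where "D i = grad_change f \<gamma> i s" for i
  define \<Delta> where "\<Delta> = grad F (x - \<gamma> *\<^sub>R g) - grad F x"
  \<comment> \<open>\<open>a I\<close> is the error that would result from transmitting the sampled
    gradient changes exactly, that is, the conditional mean of the new error given
    \<open>I\<close>.\<close>
  define a where "a I = (g - grad F x) + (1 / real r) *\<^sub>R (\<Sum>j<r. D (I ! j) - \<Delta>)" for I :: "nat list"
  note \<omega> = quantizationD(1)[OF Q]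
  have V: "0 \<le> V s" by (simp add: V_def)
  have inner: "(\<integral>\<^sup>+ m. ennreal ((norm (fst (snd (compressed_state \<gamma> r s m)) - grad F (x - \<gamma> *\<^sub>R g)))\<^sup>2)
        \<partial>PiM {..<r} (\<lambda>j. Q (D (I ! j))))
      \<le> ennreal ((norm (a I))\<^sup>2) + ennreal (\<omega> / (real r)\<^sup>2) * (\<Sum>j<r. ennreal ((norm (D (I ! j)))\<^sup>2))" for I
  proof -
    have eq: "fst (snd (compressed_state \<gamma> r s m)) - grad F (x - \<gamma> *\<^sub>R g)
        = a I + (1 / real r) *\<^sub>R (\<Sum>j<r. m j - D (I ! j))" for m
    proof -
      have "(1 / real r) *\<^sub>R (\<Sum>j<r. D (I ! j) - \<Delta>) = (1 / real r) *\<^sub>R (\<Sum>j<r. D (I ! j)) - \<Delta>"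
        using r by (simp add: sum_subtractf scaleR_diff_right sum_constant_scaleR del: sum_constant)
      then show ?thesis
        by (simp add: compressed_state_def a_def \<Delta>_def g_def[symmetric] sum_subtractf scaleR_diff_right)
    qed
    have "(\<integral>\<^sup>+ m. ennreal ((norm (a I + (1 / real r) *\<^sub>R (\<Sum>j<r. m j - D (I ! j))))\<^sup>2)
        \<partial>PiM {..<r} (\<lambda>j. Q (D (I ! j))))
      \<le> ennreal ((norm (a I))\<^sup>2 + (1 / real r)\<^sup>2 * (\<Sum>j<r. \<omega> * (norm (D (I ! j)))\<^sup>2))"
      using \<omega> by (intro nn_integral_PiM_norm_sq_sum_le quantizationD[OF Q]) auto
    also have "\<dots> = ennreal ((norm (a I))\<^sup>2 + \<omega> / (real r)\<^sup>2 * (\<Sum>j<r. (norm (D (I ! j)))\<^sup>2))"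
      by (simp add: sum_distrib_left power_divide)
    also have "\<dots> = ennreal ((norm (a I))\<^sup>2) + ennreal (\<omega> / (real r)\<^sup>2) * (\<Sum>j<r. ennreal ((norm (D (I ! j)))\<^sup>2))"
      using \<omega> by (simp add: sum_nonneg flip: ennreal_mult)
    finally show ?thesis unfolding eq .
  qed
  txt \<open>The two sources of randomness are removed one after the other: given the sampled workers,
    the compression errors are centred and independent; then so are the deviations of the sampled
    gradient changes from their mean \<open>\<Delta>\<close>.\<close>
  have "(\<integral>\<^sup>+ i. ennreal ((norm (D i - \<Delta>))\<^sup>2) \<partial>pmf_of_set {1..n}) \<le> ennreal (V s)"
    unfolding D_def \<Delta>_def x_def g_def V_def
    by (intro nn_integral_norm_sq_centered_le prob_space_measure_pmf has_bochner_integral_grad_change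
        mean_sq_grad_change_le) simp
  then have "(\<integral>\<^sup>+ I. ennreal ((norm (a I))\<^sup>2) \<partial>replicate_pmf r (pmf_of_set {1..n}))
      \<le> ennreal ((norm (g - grad F x))\<^sup>2 + (1 / real r)\<^sup>2 * (real r * V s))"
    unfolding a_def using has_bochner_integral_grad_change[of s]
    by (intro nn_integral_replicate_pmf_norm_sq_sum_le V) (auto simp: D_def \<Delta>_def x_def g_def)
  \<comment> \<open>\<open>\<omega>\<close> multiplies the squared norm of the quantized vector
    itself, so the gradient changes are averaged here without centring, unlike in the sampling
    term.\<close>
  moreover have "(\<integral>\<^sup>+ I. (\<Sum>j<r. ennreal ((norm (D (I ! j)))\<^sup>2)) \<partial>replicate_pmf r (pmf_of_set {1..n}))
      \<le> of_nat r * ennreal (V s)"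
    unfolding nn_integral_replicate_pmf_sum[where h = "\<lambda>i. ennreal ((norm (D i))\<^sup>2)"]
    using mean_sq_grad_change_le by (intro mult_left_mono) (auto simp: D_def V_def)
  ultimately have "(\<integral>\<^sup>+ I. ennreal ((norm (a I))\<^sup>2)
        + ennreal (\<omega> / (real r)\<^sup>2) * (\<Sum>j<r. ennreal ((norm (D (I ! j)))\<^sup>2)) \<partial>replicate_pmf r (pmf_of_set {1..n}))
      \<le> ennreal ((norm (g - grad F x))\<^sup>2 + (1 / real r)\<^sup>2 * (real r * V s))
        + ennreal (\<omega> / (real r)\<^sup>2) * (of_nat r * ennreal (V s))"
    by (subst nn_integral_add, simp, simp, subst nn_integral_cmult, simp) (intro add_mono mult_left_mono; simp)
  also have "\<dots> = ennreal ((norm (g - grad F x))\<^sup>2 + (1 + \<omega>) / real r * V s)"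
  proof -
    have "ennreal (\<omega> / (real r)\<^sup>2) * (of_nat r * ennreal (V s)) = ennreal (\<omega> / (real r)\<^sup>2 * (real r * V s))"
      using \<omega> V by (simp add: ennreal_of_nat_eq_real_of_nat flip: ennreal_mult)
    moreover have "(norm (g - grad F x))\<^sup>2 + (1 / real r)\<^sup>2 * (real r * V s) + \<omega> / (real r)\<^sup>2 * (real r * V s)
        = (norm (g - grad F x))\<^sup>2 + (1 + \<omega>) / real r * V s"
      using r by (simp add: field_simps power2_eq_square)
    ultimately show ?thesis using \<omega> V by (simp flip: ennreal_plus)
  qed
  finally have "(\<integral>\<^sup>+ I. \<integral>\<^sup>+ m. ennreal ((norm (fst (snd (compressed_state \<gamma> r s m)) - grad F (x - \<gamma> *\<^sub>R g)))\<^sup>2)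
        \<partial>PiM {..<r} (\<lambda>j. Q (D (I ! j))) \<partial>replicate_pmf r (pmf_of_set {1..n}))
      \<le> ennreal ((norm (g - grad F x))\<^sup>2 + (1 + \<omega>) / real r * V s)"
    by (rule order_trans[OF nn_integral_mono[OF inner]])
  then show ?thesis unfolding D_def x_def g_def .
qed

text \<open>The error survives a round only with probability \<open>1 - p\<close>. With the weight
  \<open>\<gamma> / (2 * p)\<close> the expected loss is \<open>\<gamma> / 2\<close> times the
  error, which pays for the error term in \<open>inexact_descent\<close>.\<close>

definition potential :: "real \<Rightarrow> 'd state \<Rightarrow> real" where
  "potential fstar s = F (fst s) - fstar + \<gamma> / (2 * p) * (norm (fst (snd s) - grad F (fst s)))\<^sup>2"

lemma potential_measurable [measurable]: "potential fstar \<in> borel_measurable state_space"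
  unfolding potential_def by measurable

text \<open>The next iterate is the same in both kinds of rounds, so randomness affects only the
  error term. The inequality is additive because subtraction in \<open>ennreal\<close> truncates;
  \<open>lower\<close> keeps the potential nonnegative.\<close>

lemma nn_integral_step_potential_le:
  assumes lower: "\<And>x. fstar \<le> F x"
    and \<gamma>_le: "L * \<gamma> + (1 - p) / p * ((1 + \<omega>) / real r * (L\<^sup>2 * \<gamma>\<^sup>2)) \<le> 1"
  shows "(\<integral>\<^sup>+ t. ennreal (potential fstar t) \<partial>pp_marina_step n f Q \<gamma> p r s)
      + ennreal (\<gamma> / 2 * (norm (grad F (fst s)))\<^sup>2) \<le> ennreal (potential fstar s)"
proof -
  define x g x' where "x = fst s" and "g = fst (snd s)" and "x' = x - \<gamma> *\<^sub>R g"
  define E where "E = (norm (g - grad F x))\<^sup>2 + (1 + \<omega>) / real r * (L\<^sup>2 * (\<gamma>\<^sup>2 * (norm g)\<^sup>2))"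
  note \<omega> = quantizationD(1)[OF Q]
  let ?S = "replicate_pmf r (pmf_of_set {1..n})"
  have E: "0 \<le> E" using \<omega> by (simp add: E_def)
  have x': "fst (compressed_state \<gamma> r s m) = x'" for m
    by (simp add: compressed_state_def x'_def x_def g_def)
  have F0: "0 \<le> F x' - fstar" using lower by simp
  have meas: "(\<lambda>m. fst (snd (compressed_state \<gamma> r s m))) \<in> borel_measurable (PiM {..<r} (\<lambda>j. Q (v j)))" for v
  proof -
    note [measurable_cong] = quantizationD(4)[OF Q]
    show ?thesis by measurable
  qed
  have "(\<integral>\<^sup>+ m. ennreal (potential fstar (compressed_state \<gamma> r s m)) \<partial>PiM {..<r} (\<lambda>j. Q (v j)))
      = ennreal (F x' - fstar) + ennreal (\<gamma> / (2 * p)) *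
        (\<integral>\<^sup>+ m. ennreal ((norm (fst (snd (compressed_state \<gamma> r s m)) - grad F x'))\<^sup>2) \<partial>PiM {..<r} (\<lambda>j. Q (v j)))" for v
  proof -
    interpret prob_space "PiM {..<r} (\<lambda>j. Q (v j))"
      using quantizationD(3)[OF Q] by (rule prob_space_PiM)
    note meas[measurable]
    have "(\<integral>\<^sup>+ m. ennreal (potential fstar (compressed_state \<gamma> r s m)) \<partial>PiM {..<r} (\<lambda>j. Q (v j)))
      = (\<integral>\<^sup>+ m. ennreal (F x' - fstar) + ennreal (\<gamma> / (2 * p)) *
          ennreal ((norm (fst (snd (compressed_state \<gamma> r s m)) - grad F x'))\<^sup>2) \<partial>PiM {..<r} (\<lambda>j. Q (v j)))"
      using F0 \<gamma> p by (intro nn_integral_cong) (simp add: potential_def x' flip: ennreal_plus ennreal_mult)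
    also have "\<dots> = ennreal (F x' - fstar) + ennreal (\<gamma> / (2 * p)) *
        (\<integral>\<^sup>+ m. ennreal ((norm (fst (snd (compressed_state \<gamma> r s m)) - grad F x'))\<^sup>2) \<partial>PiM {..<r} (\<lambda>j. Q (v j)))"
      by (subst nn_integral_add, simp, simp, subst nn_integral_cmult) (simp_all add: emeasure_space_1)
    finally show ?thesis .
  qed
  then have "(\<integral>\<^sup>+ I. \<integral>\<^sup>+ m. ennreal (potential fstar (compressed_state \<gamma> r s m))
        \<partial>PiM {..<r} (\<lambda>j. Q (grad_change f \<gamma> (I ! j) s)) \<partial>?S)
      = ennreal (F x' - fstar) + ennreal (\<gamma> / (2 * p)) *
        (\<integral>\<^sup>+ I. \<integral>\<^sup>+ m. ennreal ((norm (fst (snd (compressed_state \<gamma> r s m)) - grad F x'))\<^sup>2)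
          \<partial>PiM {..<r} (\<lambda>j. Q (grad_change f \<gamma> (I ! j) s)) \<partial>?S)"
    by (simp add: nn_integral_add nn_integral_cmult)
  also have "\<dots> \<le> ennreal (F x' - fstar) + ennreal (\<gamma> / (2 * p)) * ennreal E"
    using nn_integral_compressed_error_le[of s]
    by (intro add_left_mono mult_left_mono) (simp_all add: E_def x'_def x_def g_def)
  also have "\<dots> = ennreal (F x' - fstar + \<gamma> / (2 * p) * E)"
    using F0 E \<gamma> p by (simp flip: ennreal_mult)
  finally have comp: "(\<integral>\<^sup>+ I. \<integral>\<^sup>+ m. ennreal (potential fstar (compressed_state \<gamma> r s m))
        \<partial>PiM {..<r} (\<lambda>j. Q (grad_change f \<gamma> (I ! j) s)) \<partial>?S) \<le> ennreal (F x' - fstar + \<gamma> / (2 * p) * E)" .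
  have sync: "potential fstar (sync_state n f \<gamma> s) = F x' - fstar"
    by (simp add: potential_def sync_state_def Let_def x'_def x_def g_def)
  have "(\<integral>\<^sup>+ t. ennreal (potential fstar t) \<partial>pp_marina_step n f Q \<gamma> p r s)
      \<le> ennreal (F x' - fstar) * p + ennreal (F x' - fstar + \<gamma> / (2 * p) * E) * (1 - p)"
    by (subst nn_integral_step, simp, unfold sync, intro add_left_mono mult_right_mono comp) simp
  also have "\<dots> = ennreal ((F x' - fstar) * p + (F x' - fstar + \<gamma> / (2 * p) * E) * (1 - p))"
    using F0 E \<gamma> p by (simp flip: ennreal_plus ennreal_mult)
  finally have "(\<integral>\<^sup>+ t. ennreal (potential fstar t) \<partial>pp_marina_step n f Q \<gamma> p r s)
      + ennreal (\<gamma> / 2 * (norm (grad F x))\<^sup>2)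
    \<le> ennreal ((F x' - fstar) * p + (F x' - fstar + \<gamma> / (2 * p) * E) * (1 - p))
      + ennreal (\<gamma> / 2 * (norm (grad F x))\<^sup>2)" by (rule add_right_mono)
  also have "\<dots> = ennreal ((F x' - fstar) * p + (F x' - fstar + \<gamma> / (2 * p) * E) * (1 - p)
      + \<gamma> / 2 * (norm (grad F x))\<^sup>2)"
    using F0 E \<gamma> p by (simp flip: ennreal_plus)
  also have "\<dots> \<le> ennreal (potential fstar s)"
  proof (rule ennreal_leI)
    define A N e where "A = (1 - p) / p * ((1 + \<omega>) / real r * (L\<^sup>2 * \<gamma>\<^sup>2))"
      and "N = (norm g)\<^sup>2" and "e = (norm (g - grad F x))\<^sup>2"
    have descent: "F x' \<le> F x - \<gamma> / 2 * (norm (grad F x))\<^sup>2 - (\<gamma> / 2 - L * \<gamma>\<^sup>2 / 2) * N + \<gamma> / 2 * e"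
      unfolding x'_def N_def e_def by (rule inexact_descent[OF smooth_F \<gamma>])
    \<comment> \<open>Multiplied by \<open>\<gamma> / 2 * N\<close>, the step size condition says
      that the variance injected by compressed rounds is covered by the negative multiple of
      \<open>N\<close> in \<open>descent\<close>.\<close>
    have "\<gamma> / 2 * N * (L * \<gamma> + A) \<le> \<gamma> / 2 * N * 1"
      by (rule mult_left_mono[OF \<gamma>_le[folded A_def]]) (use \<gamma> in \<open>simp add: N_def\<close>)
    then have A: "\<gamma> / 2 * N * A \<le> (\<gamma> / 2 - L * \<gamma>\<^sup>2 / 2) * N"
      by (simp add: algebra_simps power2_eq_square)
    define c where "c = \<gamma> / (2 * p) * (1 - p)"
    have "c = \<gamma> / 2 * ((1 - p) / p)" by (simp add: c_def)
    then have "c * ((1 + \<omega>) / real r * (L\<^sup>2 * (\<gamma>\<^sup>2 * N))) = \<gamma> / 2 * N * A"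
      by (simp only: A_def mult.assoc mult.commute mult.left_commute)
    then have "c * E = c * e + \<gamma> / 2 * N * A"
      by (simp only: E_def e_def N_def distrib_left)
    \<comment> \<open>The part \<open>- \<gamma> / 2\<close> of \<open>c\<close> cancels the term
      \<open>\<gamma> / 2 * e\<close> of \<open>descent\<close>; the other part reproduces the
      weight of the error in the potential.\<close>
    moreover have "c = \<gamma> / (2 * p) - \<gamma> / 2"
      using p by (simp add: c_def right_diff_distrib)
    ultimately have cE: "c * E = \<gamma> / (2 * p) * e - \<gamma> / 2 * e + \<gamma> / 2 * N * A"
      by (simp only: left_diff_distrib)
    have "u * p + (u + w * E) * (1 - p) = u + w * (1 - p) * E" for u w :: real
      by (simp add: ring_distribs)
    then have mix: "(F x' - fstar) * p + (F x' - fstar + \<gamma> / (2 * p) * E) * (1 - p) = F x' - fstar + c * E"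
      by (simp only: c_def)
    have pot: "potential fstar s = F x - fstar + \<gamma> / (2 * p) * e"
      by (simp add: potential_def e_def x_def g_def)
    show "(F x' - fstar) * p + (F x' - fstar + \<gamma> / (2 * p) * E) * (1 - p)
        + \<gamma> / 2 * (norm (grad F x))\<^sup>2 \<le> potential fstar s"
      unfolding mix cE pot using descent A by linarith
  qed
  finally show ?thesis by (simp add: x_def)
qed

text \<open>The descent of the potential telescopes. Initially the estimator is exact, so the
  potential starts at the gap \<open>F x0 - fstar\<close>.\<close>

lemma sum_grad_norm_sq_le:
  assumes lower: "\<And>x. fstar \<le> F x"
    and \<gamma>_le: "L * \<gamma> + (1 - p) / p * ((1 + \<omega>) / real r * (L\<^sup>2 * \<gamma>\<^sup>2)) \<le> 1"
  shows "(\<Sum>k<K. \<integral>\<^sup>+ s. ennreal ((norm (grad F (fst s)))\<^sup>2) \<partial>pp_marina n f Q \<gamma> p r x0 k)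
    \<le> ennreal (2 * (F x0 - fstar) / \<gamma>)"
proof -
  let ?P = "pp_marina n f Q \<gamma> p r x0"
  let ?G = "\<lambda>k. \<integral>\<^sup>+ s. ennreal ((norm (grad F (fst s)))\<^sup>2) \<partial>?P k"
  \<comment> \<open>The potential after \<open>K\<close> rounds stays on the left to make the
    induction close; afterwards it is dropped as a nonnegative term.\<close>
  have "(\<integral>\<^sup>+ s. ennreal (potential fstar s) \<partial>?P K) + ennreal (\<gamma> / 2) * (\<Sum>k<K. ?G k) \<le> ennreal (F x0 - fstar)"
  proof (induction K)
    case 0
    then show ?case by (subst nn_integral_pp_marina_0) (simp_all add: potential_def)
  next
    case (Suc K)
    have "(\<integral>\<^sup>+ s. ennreal (potential fstar s) \<partial>?P (Suc K)) + ennreal (\<gamma> / 2) * ?G K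
      = (\<integral>\<^sup>+ s. (\<integral>\<^sup>+ t. ennreal (potential fstar t) \<partial>pp_marina_step n f Q \<gamma> p r s)
          + ennreal (\<gamma> / 2 * (norm (grad F (fst s)))\<^sup>2) \<partial>?P K)"
    proof -
      have m1: "(\<lambda>s. \<integral>\<^sup>+ t. ennreal (potential fstar t) \<partial>pp_marina_step n f Q \<gamma> p r s) \<in> borel_measurable (?P K)"
        unfolding measurable_cong_sets[OF sets_pp_marina refl]
        using measurable_prob_algebraD[OF step_measurable]
        by (rule measurable_compose) (rule nn_integral_measurable_subprob_algebra, measurable)
      have m2: "(\<lambda>s. ennreal (\<gamma> / 2 * (norm (grad F (fst s)))\<^sup>2)) \<in> borel_measurable (?P K)"
        by measurable
      have "ennreal (\<gamma> / 2) * ?G K = (\<integral>\<^sup>+ s. ennreal (\<gamma> / 2 * (norm (grad F (fst s)))\<^sup>2) \<partial>?P K)"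
        using \<gamma> by (subst nn_integral_cmult[symmetric]) (auto simp flip: ennreal_mult)
      then show ?thesis
        unfolding nn_integral_add[OF m1 m2] by (subst nn_integral_pp_marina_Suc) simp_all
    qed
    also have "\<dots> \<le> (\<integral>\<^sup>+ s. ennreal (potential fstar s) \<partial>?P K)"
      by (intro nn_integral_mono nn_integral_step_potential_le assms)
    finally have "(\<integral>\<^sup>+ s. ennreal (potential fstar s) \<partial>?P (Suc K)) + ennreal (\<gamma> / 2) * ?G K
        + ennreal (\<gamma> / 2) * (\<Sum>k<K. ?G k)
      \<le> (\<integral>\<^sup>+ s. ennreal (potential fstar s) \<partial>?P K) + ennreal (\<gamma> / 2) * (\<Sum>k<K. ?G k)"
      by (rule add_right_mono)
    from order_trans[OF this Suc.IH] show ?case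
      by (simp add: distrib_left add.assoc add.commute add.left_commute del: pp_marina.simps)
  qed
  then have "ennreal (\<gamma> / 2) * (\<Sum>k<K. ?G k) \<le> ennreal (F x0 - fstar)"
    by (rule order_trans[rotated]) simp
  then have "ennreal (2 / \<gamma>) * (ennreal (\<gamma> / 2) * (\<Sum>k<K. ?G k)) \<le> ennreal (2 / \<gamma>) * ennreal (F x0 - fstar)"
    by (rule mult_left_mono) simp
  moreover have "ennreal (2 / \<gamma>) * ennreal (\<gamma> / 2) = 1"
    using \<gamma> by (simp flip: ennreal_mult)
  moreover have "ennreal (2 / \<gamma>) * ennreal (F x0 - fstar) = ennreal (2 * (F x0 - fstar) / \<gamma>)"
    using \<gamma> lower[of x0] by (simp flip: ennreal_mult)
  ultimately show ?thesis by (simp flip: mult.assoc)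
qed

section \<open>The law of the returned point\<close>

lemma nn_integral_output:
  assumes [measurable]: "h \<in> borel_measurable borel" and K: "1 \<le> K"
  shows "(\<integral>\<^sup>+ x. h x \<partial>pp_marina_output n f Q \<gamma> p r x0 K)
    = (\<Sum>k<K. \<integral>\<^sup>+ s. h (fst s) \<partial>pp_marina n f Q \<gamma> p r x0 k) / of_nat K"
proof -
  have "distr (pp_marina n f Q \<gamma> p r x0 k) borel fst \<in> space (prob_algebra borel)" for k
  proof -
    interpret prob_space "pp_marina n f Q \<gamma> p r x0 k" by (rule prob_space_pp_marina)
    have "prob_space (distr (pp_marina n f Q \<gamma> p r x0 k) borel fst)"
      by (rule prob_space_distr) measurable
    then show ?thesis by (simp add: space_prob_algebra)
  qed
  then have "(\<lambda>k. distr (pp_marina n f Q \<gamma> p r x0 k) borel fst)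
      \<in> measure_pmf (pmf_of_set {..<K}) \<rightarrow>\<^sub>M subprob_algebra borel"
    using prob_algebra_subset by (auto simp only: measurable_pmf_measure1 Pi_iff)
  then have "(\<integral>\<^sup>+ x. h x \<partial>pp_marina_output n f Q \<gamma> p r x0 K)
      = (\<integral>\<^sup>+ k. \<integral>\<^sup>+ x. h x \<partial>distr (pp_marina n f Q \<gamma> p r x0 k) borel fst \<partial>pmf_of_set {..<K})"
    unfolding pp_marina_output_def by (rule nn_integral_bind[OF assms(1)])
  also have "\<dots> = (\<integral>\<^sup>+ k. \<integral>\<^sup>+ s. h (fst s) \<partial>pp_marina n f Q \<gamma> p r x0 k \<partial>pmf_of_set {..<K})"
    by (intro nn_integral_cong nn_integral_distr) measurable
  \<comment> \<open>\<open>1 \<le> K\<close> makes the index set nonempty, as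
    \<open>pmf_of_set\<close> requires.\<close>
  finally show ?thesis
    using K by (simp add: nn_integral_pmf_of_set lessThan_empty_iff)
qed

end

subsection \<open>Convergence rate\<close>

lemma grad_zero: "grad (\<lambda>_. 0) x = 0"
  by (rule grad_eqI) (rule GDERIV_const)

lemma smooth_zero: "smooth 0 (\<lambda>_. 0)"
  by (simp add: smooth_def grad_zero)

text \<open>With \<open>t = sqrt a * (L * \<gamma>)\<close> the bound on \<open>\<gamma>\<close>
  reads \<open>L * \<gamma> + t \<le> 1\<close>. Hence \<open>t\<close> lies between 0 and 1, and
  its square is at most \<open>t\<close>.\<close>

lemma stepsize_condition:
  fixes \<gamma> L a :: real
  assumes "0 \<le> a" and "0 < \<gamma>" and "0 < L" and "\<gamma> \<le> 1 / (L * (1 + sqrt a))"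
  shows "L * \<gamma> + a * (L\<^sup>2 * \<gamma>\<^sup>2) \<le> 1"
proof -
  have s: "0 \<le> sqrt a" using assms by simp
  have t: "0 < L * \<gamma>" using assms by simp
  have "L * \<gamma> * (1 + sqrt a) \<le> 1"
    using assms s by (simp add: pos_le_divide_eq add_pos_nonneg algebra_simps)
  then have u: "L * \<gamma> + sqrt a * (L * \<gamma>) \<le> 1" by (simp add: algebra_simps)
  then have "sqrt a * (L * \<gamma>) \<le> 1" using t by linarith
  then have "(sqrt a * (L * \<gamma>))\<^sup>2 \<le> sqrt a * (L * \<gamma>)"
    using s t mult_right_le_one_le[of "sqrt a * (L * \<gamma>)" "sqrt a * (L * \<gamma>)"]
    by (simp add: power2_eq_square)
  moreover have "(sqrt a * (L * \<gamma>))\<^sup>2 = a * (L\<^sup>2 * \<gamma>\<^sup>2)"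
    using assms by (simp add: power_mult_distrib)
  ultimately show ?thesis using u by linarith
qed

text \<open>The asymptotic bounds get explicit constants. \<open>\<theta>\<close> controls how far
  \<open>\<gamma>\<close> may lie below its maximal value \<open>B\<close>: smaller steps need
  proportionally more iterations, hence the factors \<open>1 / \<theta>\<close>. The maximum with 1
  leaves room for the one iterate that an output needs.\<close>

theorem corollaryE1:
  fixes f :: "nat \<Rightarrow> real ^ 'd::finite \<Rightarrow> real"
    and Q :: "real ^ 'd \<Rightarrow> (real ^ 'd) measure"
    and n r d :: nat
    and x0 :: "real ^ 'd"
    and Ls :: "nat \<Rightarrow> real"
    and fstar L \<Delta>0 \<omega> \<zeta> p \<gamma> B \<theta> \<epsilon> :: real
  assumes "1 \<le> r" and "r \<le> n" and "d = CARD('d)"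
    and "\<And>x. objective n f x \<ge> fstar"
    and "\<And>i. i \<in> {1..n} \<Longrightarrow> smooth (Ls i) (f i)"
    and "L = sqrt ((1 / real n) * (\<Sum>i=1..n. (Ls i)\<^sup>2))"
    and "\<Delta>0 = objective n f x0 - fstar"
    and "quantization \<omega> Q" and "\<zeta> = expected_density Q"
    and "p = \<zeta> * real r / (real d * real n)"
    and "B = 1 / (L * (1 + sqrt ((1 + \<omega>) / real r * (real d * real n / (\<zeta> * real r) - 1))))"
    and "0 < \<gamma>" and "\<gamma> \<le> B"
    and "0 < \<theta>" and "\<theta> \<le> 1" and "\<theta> * B \<le> \<gamma>"
    and "0 < \<epsilon>"
  shows "\<exists>K\<ge>1.
      real K \<le> max 1 (4 / \<theta> * (\<Delta>0 * L / \<epsilon>\<^sup>2 *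
        (1 + sqrt ((1 + \<omega>) / real r * (real d * real n / (\<zeta> * real r) - 1))))) \<and>
      (\<integral>\<^sup>+ x. ennreal ((norm (grad (objective n f) x))\<^sup>2) \<partial>pp_marina_output n f Q \<gamma> p r x0 K)
        \<le> ennreal (\<epsilon>\<^sup>2) \<and>
      expected_cost n f Q \<gamma> p r x0 K \<le> ennreal (8 / \<theta> * (real d * real n + \<Delta>0 * L / \<epsilon>\<^sup>2 *
        (\<zeta> * real r + sqrt ((1 + \<omega>) * \<zeta> * (real d * real n - \<zeta> * real r)))))"
proof -
  define S where "S = sqrt ((1 + \<omega>) / real r * (real d * real n / (\<zeta> * real r) - 1))"
  define M where "M = \<Delta>0 * L / \<epsilon>\<^sup>2 * (1 + S)"
  note \<omega> = quantizationD(1)[OF assms(8)]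
  note \<zeta> = quantization_nnz(3,4)[OF assms(8), folded assms(9), folded assms(3)]
  have d: "0 < real d" using assms(3) by simp
  have r: "1 \<le> real r" and rn: "real r \<le> real n" and n: "1 \<le> n" using assms(1,2) by simp_all
  have \<zeta>r: "0 < \<zeta> * real r" "\<zeta> * real r \<le> real d * real n"
    using \<zeta> r rn by (auto intro!: mult_mono)
  then have p: "0 < p" "p \<le> 1" using assms(10) d r rn by simp_all
  \<comment> \<open>Since \<open>p\<close> is the reciprocal of the ratio under the root, the
    radicand is the variance coefficient in the step size condition for the potential.\<close>
  have a: "(1 + \<omega>) / real r * (real d * real n / (\<zeta> * real r) - 1) = (1 - p) / p * ((1 + \<omega>) / real r)"
  proof -
    have "real d * real n / (\<zeta> * real r) = 1 / p" unfolding assms(10) by simp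
    moreover have "1 / p - 1 = (1 - p) / p" using p by (simp add: diff_divide_distrib)
    ultimately show ?thesis by (simp only: mult.commute)
  qed
  have a0: "0 \<le> (1 - p) / p * ((1 + \<omega>) / real r)" using p \<omega> r by simp
  have S: "0 \<le> S" unfolding S_def a using a0 by simp
  have B: "B = 1 / (L * (1 + S))" unfolding assms(11) S_def ..
  have "0 \<le> L" using assms(6) by (simp add: sum_nonneg)
  \<comment> \<open>For \<open>L = 0\<close>, division by zero would give \<open>B = 0\<close>,
    contradicting \<open>0 < \<gamma>\<close> and \<open>\<gamma> \<le> B\<close>.\<close>
  moreover have "L \<noteq> 0" using assms(12,13) B by auto
  ultimately have L: "0 < L" by simp
  have \<Delta>: "0 \<le> \<Delta>0" using assms(4)[of x0] assms(7) by simp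
  have M: "0 \<le> M" using \<Delta> L S by (simp add: M_def)

  txt \<open>The kernels are defined on all index lists, also those with entries outside
    \<open>{1..n}\<close>, where nothing is known about \<open>f\<close>; replacing \<open>f\<close> by zero there makes
    all of them measurable and does not change the algorithm.\<close>
  define f' where "f' i = (if i \<in> {1..n} then f i else (\<lambda>_. 0))" for i
  define Ls' where "Ls' i = (if i \<in> {1..n} then Ls i else 0)" for i
  have ff': "f i = f' i" if "i \<in> {1..n}" for i using that by (simp add: f'_def)
  have obj: "objective n f = objective n f'" by (simp add: objective_def fun_eq_iff ff')
  have run: "pp_marina n f Q \<gamma> p r x0 k = pp_marina n f' Q \<gamma> p r x0 k" for k
    using assms(8) n ff' by (rule pp_marina_cong)
  interpret smooth_marina n r f' Ls' Q \<omega> \<gamma> p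
    using n assms(1,5,8,12) p smooth_zero by unfold_locales (auto simp: f'_def Ls'_def)
  have LL: "smooth_marina.L n Ls' = L"
    unfolding L_def assms(6) by (simp add: Ls'_def)

  \<comment> \<open>\<open>X\<close> solves
    \<open>2 * \<Delta>0 / (\<gamma> * X) = \<epsilon>\<^sup>2\<close> when \<open>\<Delta>0\<close>
    is positive; it is the iteration count before rounding.\<close>
  define X where "X = 2 * \<Delta>0 / (\<gamma> * \<epsilon>\<^sup>2)"
  \<comment> \<open>The maximum matters when \<open>\<Delta>0 = 0\<close>: then \<open>X\<close> is
    0, but the output still needs one iterate.\<close>
  define K where "K = max 1 (nat \<lceil>X\<rceil>)"
  have X0: "0 \<le> X" using \<Delta> assms(12) by (simp add: X_def)
  have K1: "1 \<le> K" by (simp add: K_def)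
  have XK: "X \<le> real K" unfolding K_def by linarith
  have XM: "X \<le> 2 / \<theta> * M"
  proof -
    \<comment> \<open>The lower bound \<open>\<theta> * B \<le> \<gamma>\<close> enters here and
      limits \<open>1 / \<gamma>\<close>.\<close>
    have "\<theta> \<le> \<gamma> * (L * (1 + S))"
      using assms(16) L S by (simp add: B pos_divide_le_eq add_pos_nonneg)
    then have "1 / \<gamma> \<le> L * (1 + S) / \<theta>"
      using assms(12,14) by (simp add: field_simps)
    then have "2 * \<Delta>0 / \<epsilon>\<^sup>2 * (1 / \<gamma>) \<le> 2 * \<Delta>0 / \<epsilon>\<^sup>2 * (L * (1 + S) / \<theta>)"
      using \<Delta> by (intro mult_left_mono) auto
    then show ?thesis by (simp add: X_def M_def mult.commute mult.left_commute)
  qed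
  \<comment> \<open>Rounding up adds less than 1. For \<open>X > 1\<close> this at most doubles
    \<open>X\<close> and turns the constant 2 into 4; otherwise \<open>K = 1\<close>.\<close>
  have K: "real K \<le> max 1 (4 / \<theta> * M)"
  proof (cases "X \<le> 1")
    case True
    then have "nat \<lceil>X\<rceil> \<le> 1" by linarith
    then show ?thesis by (simp add: K_def)
  next
    case False
    then have "real K \<le> X + 1" unfolding K_def by linarith
    with False XM show ?thesis by linarith
  qed

  have grad: "(\<integral>\<^sup>+ x. ennreal ((norm (grad (objective n f) x))\<^sup>2) \<partial>pp_marina_output n f Q \<gamma> p r x0 K)
      \<le> ennreal (\<epsilon>\<^sup>2)"
  proof -
    have "(\<integral>\<^sup>+ x. ennreal ((norm (grad (objective n f) x))\<^sup>2) \<partial>pp_marina_output n f Q \<gamma> p r x0 K)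
      = (\<integral>\<^sup>+ x. ennreal ((norm (grad F x))\<^sup>2) \<partial>pp_marina_output n f' Q \<gamma> p r x0 K)"
      by (simp only: pp_marina_output_def run obj)
    also have "\<dots> = (\<Sum>k<K. \<integral>\<^sup>+ s. ennreal ((norm (grad F (fst s)))\<^sup>2) \<partial>pp_marina n f' Q \<gamma> p r x0 k) / of_nat K"
      using K1 by (intro nn_integral_output) measurable
    also have "\<dots> \<le> ennreal (2 * (F x0 - fstar) / \<gamma>) / of_nat K"
    proof (intro divide_right_mono_ennreal sum_grad_norm_sq_le)
      show "fstar \<le> F x" for x using assms(4)[of x] by (simp add: obj)
      show "smooth_marina.L n Ls' * \<gamma> + (1 - p) / p * ((1 + \<omega>) / real r * ((smooth_marina.L n Ls')\<^sup>2 * \<gamma>\<^sup>2)) \<le> 1"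
        using stepsize_condition[OF a0 assms(12) L assms(13)[unfolded B S_def a]]
        unfolding LL by (simp only: mult.assoc)
    qed
    also have "\<dots> = ennreal (2 * \<Delta>0 / \<gamma> / real K)"
      unfolding assms(7) obj using K1 assms(4)[of x0] assms(12)
      by (subst ennreal_of_nat_eq_real_of_nat, subst divide_ennreal) (simp_all add: obj)
    also have "2 * \<Delta>0 / \<gamma> = X * \<epsilon>\<^sup>2"
      unfolding X_def using assms(17) by simp
    also have "ennreal (X * \<epsilon>\<^sup>2 / real K) \<le> ennreal (\<epsilon>\<^sup>2)"
      using mult_right_mono[OF XK, of "\<epsilon>\<^sup>2"] K1 by (intro ennreal_leI) (simp add: pos_divide_le_eq mult.commute)
    finally show ?thesis .
  qed

  have cost: "expected_cost n f Q \<gamma> p r x0 K \<le> ennreal (8 / \<theta> * (real d * real n + \<Delta>0 * L / \<epsilon>\<^sup>2 *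
        (\<zeta> * real r + sqrt ((1 + \<omega>) * \<zeta> * (real d * real n - \<zeta> * real r)))))"
  proof -
    have "expected_cost n f Q \<gamma> p r x0 K = expected_cost n f' Q \<gamma> p r x0 K"
      by (simp only: expected_cost_def run)
    also have "\<dots> \<le> ennreal (real CARD('d) * real n + real K * (2 * expected_density Q * real r))"
      using assms(3,9,10) d n by (intro expected_cost_le) simp
    also have "\<dots> = ennreal (real d * real n + real K * (2 * (\<zeta> * real r)))"
      using assms(3,9) by (simp add: mult.assoc)
    also have "\<dots> \<le> ennreal (8 / \<theta> * (real d * real n + M * (\<zeta> * real r)))"
    proof (rule ennreal_leI)
      \<comment> \<open>The constant 8 is twice the 4 from the bound on \<open>K\<close>, as a round
        costs at most \<open>2 \<zeta> r\<close>. It leaves room in the first summand, where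
        \<open>d n + 2 \<zeta> r \<le> 3 d n\<close>.\<close>
      have \<theta>: "1 \<le> 1 / \<theta>" using assms(14,15) by simp
      have M': "0 \<le> 4 / \<theta> * M" using M assms(14) by simp
      have "real K \<le> 1 + 4 / \<theta> * M" using K M' by linarith
      then have "real K * (2 * (\<zeta> * real r)) \<le> (1 + 4 / \<theta> * M) * (2 * (\<zeta> * real r))"
        using \<zeta>r by (intro mult_right_mono) auto
      also have "\<dots> = 2 * (\<zeta> * real r) + 8 / \<theta> * (M * (\<zeta> * real r))"
        by (simp add: algebra_simps)
      finally have "real d * real n + real K * (2 * (\<zeta> * real r))
          \<le> 8 * (real d * real n) + 8 / \<theta> * (M * (\<zeta> * real r))"
        using \<zeta>r by linarith
      also have "8 * (real d * real n) \<le> 8 / \<theta> * (real d * real n)"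
        using mult_right_mono[OF \<theta>, of "8 * (real d * real n)"] by simp
      finally show "real d * real n + real K * (2 * (\<zeta> * real r))
          \<le> 8 / \<theta> * (real d * real n + M * (\<zeta> * real r))"
        by (simp add: distrib_left)
    qed
    also have "M * (\<zeta> * real r) = \<Delta>0 * L / \<epsilon>\<^sup>2 *
        (\<zeta> * real r + sqrt ((1 + \<omega>) * \<zeta> * (real d * real n - \<zeta> * real r)))"
    proof -
      \<comment> \<open>The factor \<open>\<zeta> * real r\<close> goes under the root as its square
        \<open>W\<^sup>2\<close>, where \<open>(D / W - 1) * W\<^sup>2 = W * (D - W)\<close>; the
        division by \<open>real r\<close> then leaves a single \<open>\<zeta>\<close> in
        front.\<close>
      have "S * (\<zeta> * real r) = sqrt ((1 + \<omega>) / real r * (real d * real n / (\<zeta> * real r) - 1) * (\<zeta> * real r)\<^sup>2)"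
        using \<zeta>r(1) by (simp only: S_def real_sqrt_mult real_sqrt_abs abs_of_pos)
      also have "(1 + \<omega>) / real r * (real d * real n / (\<zeta> * real r) - 1) * (\<zeta> * real r)\<^sup>2
          = (1 + \<omega>) * \<zeta> * (real d * real n - \<zeta> * real r)"
      proof -
        have "(D / W - 1) * W\<^sup>2 = W * (D - W)" if "0 < W" for D W :: real
          using that by (simp add: field_simps power2_eq_square)
        from this[OF \<zeta>r(1)] show ?thesis
          using r by (simp only: mult.assoc) simp
      qed
      finally have "S * (\<zeta> * real r) = sqrt ((1 + \<omega>) * \<zeta> * (real d * real n - \<zeta> * real r))" .
      then show ?thesis by (simp only: M_def distrib_left distrib_right mult.assoc mult_1)
    qed
    finally show ?thesis .
  qed

  show ?thesis
    using K1 K grad cost unfolding M_def S_def by (intro exI[of _ K] conjI)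
qed

end
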